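(* Let $\mathfrak{D}=\{z\in\mathbb{Z}_p:\ |T_1(z)|_p=1\}$. The sequence of functions $I_s(z)=T_{s+1}(z)/T_s(z^p)$, $s=0,1,\dots$, converges uniformly on $\mathfrak{D}$ to an analytic $\mathbb{Z}_p$-valued function. If $I(z)$ denotes this function, then $|I(a)|_p=1$ for every $a\in\mathfrak{D}$.
   Context: Standing setup. Fix integers $k\ge 1$ and $n\ge 2k$, positive integers $r,q$ with $r/q\le 1/2$, and an odd prime $p$ of the form $p=\ell q+1$ with $\ell$ a positive integer. For $1\le i\le n-1$ put $v_i=i$ if $i<k$, $v_i=k$ if $k\le i\le n-k$, and $v_i=n-i$ if $i>n-k$. Let $x=(x_{i,j})$, $1\le i\le n-1$, $1\le j\le v_i$, be $k(n-k)$ variables and $z$ one more variable. Put $$\Delta(x)=\prod_{m=1}^{n-1}\ \prod_{1\le i<j\le v_m}(x_{m,j}-x_{m,i}),$$ and for $s\ge 1$ $$\bar\Phi_s(x,z)=\Big(\prod_{i=1}^{n-1}\prod_{j=1}^{v_i}x_{i,j}\Big)^{\frac{(p^s-1)(q-r)}{q}}\Delta(x)^{\frac{(p^s-1)(q-2r)}{q}}\Big(\prod_{i=1}^{n-2}\prod_{a=1}^{v_i}\prod_{b=1}^{v_{i+1}}(x_{i,a}-x_{i+1,b})\Big)^{\frac{(p^s-1)r}{q}}\Big(\prod_{i=1}^{k}(z-x_{k,i})(1-x_{n-k,i})\Big)^{\frac{(p^s-1)r}{q}},$$ $$\Phi_s(x,z)=\Delta(x)\,\bar\Phi_s(x,z)\in\mathbb{Z}[x,z].$$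 For pairs $(i,j)$ put $e_{i,j}=|i-k|+2j-1$, and let $$N=k+\#\{(i,a,b):\ 1\le i\le n-2,\ 1\le a\le v_i,\ 1\le b\le v_{i+1},\ e_{i,a}<e_{i+1,b}\}.$$ For $s\ge1$ define $T_s(z)=(-1)^{\frac{(p^s-1)r}{q}N}$ times the coefficient of the monomial $\prod_{i,j}x_{i,j}^{\,jp^s-1}$ in $\Phi_s(x,z)$; and $T_0(z)=1$. For $u\in\mathbb{F}_p$ let $\tilde u\in\mathbb{Z}_p$ be its Teichmüller lift (the unique lift with $\tilde u^p=\tilde u$) and $D_u=\{a\in\mathbb{Z}_p:|a-\tilde u|_p<1\}$; the set $\mathfrak{D}$ is a union of such discs $D_u$. A function on $\mathfrak{D}$ is analytic if on each disc $D_u\subset\mathfrak{D}$ it is given by a power series in $z-\tilde u$ convergent on $D_u$. *)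

theory Defs
  imports
    "HOL-Analysis.Analysis"
    "HOL-Library.Poly_Mapping"
    "HOL-Computational_Algebra.Polynomial"
    "HOL-Computational_Algebra.Squarefree"
    "Berlekamp_Zassenhaus.Finite_Field"
begin

section \<open>The field of p-adic numbers\<close>

text \<open>
  The distribution has no p-adic numbers. As for the prime fields \<^typ>\<open>'p mod_ring\<close>,
  the prime is the cardinality of a type \<^typ>\<open>'p\<close> of class \<^class>\<open>prime_card\<close>;
  \<open>'p padic\<close> is the completion of \<^typ>\<open>rat\<close> for the absolute value with
  \<open>|p| = 1/p\<close>, that is, the field of Cauchy sequences modulo null sequences.
\<close>

definition rat_pval :: "nat \<Rightarrow> rat \<Rightarrow> int" where
  "rat_pval p x = int (multiplicity (int p) (fst (quotient_of x)))
                - int (multiplicity (int p) (snd (quotient_of x)))"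

definition rat_pabs :: "nat \<Rightarrow> rat \<Rightarrow> real" where
  "rat_pabs p x = (if x = 0 then 0 else real p powi (- rat_pval p x))"

lemma rat_pval_Fract:
  assumes "prime p" "a \<noteq> 0" "b \<noteq> 0"
  shows "rat_pval p (Rat.Fract a b) = int (multiplicity (int p) a) - int (multiplicity (int p) b)"
proof -
  obtain c d where cd: "quotient_of (Rat.Fract a b) = (c, d)" by fastforce
  have d: "d > 0" using quotient_of_denom_pos[OF cd] .
  have eq: "Rat.Fract a b = Rat.Fract c d" using cd
    by (metis Fract_of_int_quotient quotient_of_div)
  then have ad: "a * d = c * b" using assms d by (simp add: eq_rat)
  with assms d have c: "c \<noteq> 0" by auto
  have pe: "prime_elem (int p)" using assms by auto
  have "multiplicity (int p) a + multiplicity (int p) d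
      = multiplicity (int p) c + multiplicity (int p) b"
    using ad pe c d assms by (metis less_irrefl prime_elem_multiplicity_mult_distrib)
  then show ?thesis unfolding rat_pval_def cd by simp
qed

lemma rat_pabs_0 [simp]: "rat_pabs p 0 = 0"
  by (simp add: rat_pabs_def)

lemma rat_pabs_nonneg [simp]: "rat_pabs p x \<ge> 0"
  by (simp add: rat_pabs_def)

lemma rat_pabs_1 [simp]: "rat_pabs p 1 = 1"
  by (simp add: rat_pabs_def rat_pval_def)

lemma rat_pabs_minus [simp]: "rat_pabs p (- x) = rat_pabs p x"
  by (simp add: rat_pabs_def rat_pval_def rat_uminus_code split_beta )

lemma rat_pabs_mult:
  assumes "prime p"
  shows "rat_pabs p (x * y) = rat_pabs p x * rat_pabs p y"
proof (cases "x = 0 \<or> y = 0")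
  case False
  obtain a b where x: "x = Rat.Fract a b" "b > 0" by (cases x) auto
  obtain c d where y: "y = Rat.Fract c d" "d > 0" by (cases y) auto
  have nz: "a \<noteq> 0" "c \<noteq> 0" using False x y by (auto simp: rat_number_collapse)
  have pe: "prime_elem (int p)" using assms by auto
  have p: "real p \<noteq> 0" using assms prime_gt_0_nat by fastforce
  have "rat_pval p (x * y) = rat_pval p x + rat_pval p y"
    using x y nz assms pe by (simp add: rat_pval_Fract prime_elem_multiplicity_mult_distrib)
  then have "real p powi (- rat_pval p (x * y)) = real p powi (- rat_pval p x + - rat_pval p y)"
    by simp
  also have "\<dots> = real p powi (- rat_pval p x) * real p powi (- rat_pval p y)"
    using p by (subst power_int_add) auto
  finally show ?thesis using False
    by (simp add: rat_pabs_def)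
qed auto

lemma rat_pabs_add_le_max:
  assumes "prime p"
  shows "rat_pabs p (x + y) \<le> max (rat_pabs p x) (rat_pabs p y)"
proof (cases "x = 0 \<or> y = 0 \<or> x + y = 0")
  case True
  then show ?thesis by (auto simp: le_max_iff_disj)
next
  case False
  obtain a b where x: "x = Rat.Fract a b" "b > 0" by (cases x) auto
  obtain c d where y: "y = Rat.Fract c d" "d > 0" by (cases y) auto
  define A B where "A = a * d" and "B = c * b"
  have xy: "x = Rat.Fract A (b * d)" "y = Rat.Fract B (b * d)" "x + y = Rat.Fract (A + B) (b * d)"
    using x y by (auto simp: A_def B_def eq_rat mult_ac)
  note val = rat_pval_Fract[OF assms, of _ "b * d"]
  have nz: "A \<noteq> 0" "B \<noteq> 0" "A + B \<noteq> 0" "b * d \<noteq> 0"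
    using False xy x y by (auto simp: rat_number_collapse)
  have pi: "\<not> is_unit (int p)" using assms by auto
  let ?m = "multiplicity (int p)"
  have "int p ^ min (?m A) (?m B) dvd A + B"
    by (intro dvd_add multiplicity_dvd') auto
  then have "min (?m A) (?m B) \<le> ?m (A + B)"
    using nz pi by (intro multiplicity_geI) auto
  then have "rat_pval p (x + y) \<ge> min (rat_pval p x) (rat_pval p y)"
    unfolding xy(3) unfolding xy(1,2) using val[OF nz(1)] val[OF nz(2)] val[OF nz(3)] nz(4)
    by simp
  moreover have "real p \<ge> 1" using assms prime_ge_1_nat by force
  ultimately show ?thesis using False
    by (auto simp: rat_pabs_def le_max_iff_disj min_def split: if_splits
             intro: power_int_increasing)
qed

lemma rat_pabs_triangle:
  assumes "prime p"
  shows "rat_pabs p (x + y) \<le> rat_pabs p x + rat_pabs p y"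
  using rat_pabs_add_le_max[OF assms, of x y]
  by (smt (verit) rat_pabs_nonneg)

lemma rat_pabs_minus_commute: "rat_pabs p (x - y) = rat_pabs p (y - x)"
  by (metis minus_diff_eq rat_pabs_minus)

lemma rat_pabs_diff_ineq:
  assumes "prime p"
  shows "\<bar>rat_pabs p x - rat_pabs p y\<bar> \<le> rat_pabs p (x - y)"
  using rat_pabs_triangle[OF assms, of "x - y" y] rat_pabs_triangle[OF assms, of "y - x" x]
    rat_pabs_minus_commute[of p x y] by auto

lemma rat_pabs_eq_0_iff:
  assumes "prime p"
  shows "rat_pabs p x = 0 \<longleftrightarrow> x = 0"
  using prime_gt_0_nat[OF assms] by (simp add: rat_pabs_def)

lemma rat_pabs_inverse:
  assumes "prime p"
  shows "rat_pabs p (inverse x) = inverse (rat_pabs p x)"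
proof (cases "x = 0")
  case False
  then have "rat_pabs p (inverse x) * rat_pabs p x = 1"
    by (simp flip: rat_pabs_mult[OF assms])
  then show ?thesis by (metis inverse_unique mult.commute)
qed auto


definition pnull :: "nat \<Rightarrow> (nat \<Rightarrow> rat) \<Rightarrow> bool" where
  "pnull p X \<longleftrightarrow> (\<lambda>n. rat_pabs p (X n)) \<longlonglongrightarrow> 0"

definition pcauchy :: "nat \<Rightarrow> (nat \<Rightarrow> rat) \<Rightarrow> bool" where
  "pcauchy p X \<longleftrightarrow> (\<forall>e>0. \<exists>M. \<forall>m\<ge>M. \<forall>n\<ge>M. rat_pabs p (X m - X n) < e)"

lemma pnull_le:
  assumes "\<And>n. rat_pabs p (X n) \<le> f n" "f \<longlonglongrightarrow> 0"
  shows "pnull p X"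
  unfolding pnull_def
  by (rule tendsto_sandwich[OF _ _ tendsto_const assms(2)]) (auto simp: assms(1))

lemma pnull_0 [simp]: "pnull p (\<lambda>n. 0)"
  by (simp add: pnull_def)

lemma pnull_minus: "pnull p X \<Longrightarrow> pnull p (\<lambda>n. - X n)"
  by (simp add: pnull_def)

lemma pnull_add:
  assumes "prime p" "pnull p X" "pnull p Y"
  shows "pnull p (\<lambda>n. X n + Y n)"
  by (rule pnull_le[where f = "\<lambda>n. rat_pabs p (X n) + rat_pabs p (Y n)"])
     (use assms rat_pabs_triangle in \<open>auto simp: pnull_def intro!: tendsto_add_zero\<close>)

lemma pcauchy_const [simp]: "pcauchy p (\<lambda>n. c)"
  by (simp add: pcauchy_def)

lemma pcauchy_minus: "pcauchy p X \<Longrightarrow> pcauchy p (\<lambda>n. - X n)"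
  unfolding pcauchy_def
  by (metis minus_diff_minus rat_pabs_minus)

lemma pcauchy_add:
  assumes p: "prime p" and "pcauchy p X" "pcauchy p Y"
  shows "pcauchy p (\<lambda>n. X n + Y n)"
  unfolding pcauchy_def
proof (intro allI impI)
  fix e :: real assume e: "e > 0"
  obtain M where M: "\<forall>m\<ge>M. \<forall>n\<ge>M. rat_pabs p (X m - X n) < e" using assms e
    unfolding pcauchy_def by blast
  obtain N where N: "\<forall>m\<ge>N. \<forall>n\<ge>N. rat_pabs p (Y m - Y n) < e" using assms e
    unfolding pcauchy_def by blast
  have "rat_pabs p ((X m + Y m) - (X n + Y n)) < e"
    if "m \<ge> max M N" "n \<ge> max M N" for m n
    using that M N rat_pabs_add_le_max[OF p, of "X m - X n" "Y m - Y n"]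
    unfolding add_diff_add by (smt (verit) max.bounded_iff)
  then show "\<exists>M. \<forall>m\<ge>M. \<forall>n\<ge>M. rat_pabs p ((X m + Y m) - (X n + Y n)) < e" by blast
qed

lemma pcauchy_convergent:
  assumes p: "prime p" and "pcauchy p X"
  shows "convergent (\<lambda>n. rat_pabs p (X n))"
proof -
  have "Cauchy (\<lambda>n. rat_pabs p (X n))"
    using assms(2) rat_pabs_diff_ineq[OF p]
    unfolding Cauchy_def pcauchy_def dist_real_def by (meson le_less_trans)
  then show ?thesis by (simp add: Cauchy_convergent_iff)
qed

lemma pcauchy_bounded:
  assumes p: "prime p" and "pcauchy p X"
  obtains B where "B > 0" "\<And>n. rat_pabs p (X n) \<le> B"
  using convergent_imp_Bseq[OF pcauchy_convergent[OF assms]]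
  unfolding Bseq_def by auto

lemma pcauchy_mult:
  assumes p: "prime p" and X: "pcauchy p X" and Y: "pcauchy p Y"
  shows "pcauchy p (\<lambda>n. X n * Y n)"
  unfolding pcauchy_def
proof (intro allI impI)
  fix e :: real assume e: "e > 0"
  obtain A where A: "A > 0" "\<And>n. rat_pabs p (X n) \<le> A" using pcauchy_bounded[OF p X] by blast
  obtain B where B: "B > 0" "\<And>n. rat_pabs p (Y n) \<le> B" using pcauchy_bounded[OF p Y] by blast
  obtain M where M: "\<forall>m\<ge>M. \<forall>n\<ge>M. rat_pabs p (X m - X n) < e / B" using X e B
    unfolding pcauchy_def by (meson divide_pos_pos)
  obtain N where N: "\<forall>m\<ge>N. \<forall>n\<ge>N. rat_pabs p (Y m - Y n) < e / A" using Y e A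
    unfolding pcauchy_def by (meson divide_pos_pos)
  have "rat_pabs p (X m * Y m - X n * Y n) < e"
    if mn: "m \<ge> max M N" "n \<ge> max M N" for m n
  proof -
    have "rat_pabs p (X m * (Y m - Y n)) \<le> A * rat_pabs p (Y m - Y n)"
      using A by (simp add: rat_pabs_mult[OF p] mult_right_mono)
    also have "\<dots> < e" using N mn A by (simp add: field_simps)
    finally have 1: "rat_pabs p (X m * (Y m - Y n)) < e" .
    have "rat_pabs p ((X m - X n) * Y n) \<le> rat_pabs p (X m - X n) * B"
      using B by (simp add: rat_pabs_mult[OF p] mult_left_mono)
    also have "\<dots> < e" using M mn B by (simp add: field_simps)
    finally have 2: "rat_pabs p ((X m - X n) * Y n) < e" .
    show ?thesis unfolding mult_diff_mult
      using rat_pabs_add_le_max[OF p, of "X m * (Y m - Y n)" "(X m - X n) * Y n"] 1 2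
      by linarith
  qed
  then show "\<exists>M. \<forall>m\<ge>M. \<forall>n\<ge>M. rat_pabs p (X m * Y m - X n * Y n) < e" by blast
qed

lemma pnull_mult:
  assumes p: "prime p" and X: "pcauchy p X" and Y: "pnull p Y"
  shows "pnull p (\<lambda>n. X n * Y n)"
proof -
  obtain A where A: "A > 0" "\<And>n. rat_pabs p (X n) \<le> A" using pcauchy_bounded[OF p X] by blast
  show ?thesis
  proof (rule pnull_le)
    show "rat_pabs p (X n * Y n) \<le> A * rat_pabs p (Y n)" for n
      using A by (simp add: rat_pabs_mult[OF p] mult_right_mono)
    show "(\<lambda>n. A * rat_pabs p (Y n)) \<longlonglongrightarrow> 0"
      using Y by (auto simp: pnull_def intro: tendsto_mult_right_zero)
  qed
qed

lemma pcauchy_not_null: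
  assumes p: "prime p" and X: "pcauchy p X" "\<not> pnull p X"
  obtains b M where "b > 0" "\<And>n. n \<ge> M \<Longrightarrow> rat_pabs p (X n) > b"
proof -
  obtain L where L: "(\<lambda>n. rat_pabs p (X n)) \<longlonglongrightarrow> L"
    using pcauchy_convergent[OF p X(1)] by (auto simp: convergent_def)
  have "L \<ge> 0" by (rule LIMSEQ_le_const[OF L]) auto
  moreover have "L \<noteq> 0" using L X(2) by (auto simp: pnull_def)
  ultimately have "L / 2 > 0" "L / 2 < L" by auto
  moreover have "eventually (\<lambda>n. rat_pabs p (X n) > L / 2) sequentially"
    using order_tendstoD(1)[OF L \<open>L / 2 < L\<close>] .
  ultimately show ?thesis using that unfolding eventually_sequentially by blast
qed

lemma rat_pabs_inverse_diff:
  assumes p: "prime p" and "b > 0" "c > 0" "rat_pabs p x > b" "rat_pabs p y > c"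
  shows "rat_pabs p (inverse x - inverse y) \<le> rat_pabs p (x - y) / (b * c)"
proof -
  have nz: "x \<noteq> 0" "y \<noteq> 0" using assms by auto
  have "rat_pabs p (inverse x - inverse y) = rat_pabs p (x - y) / (rat_pabs p x * rat_pabs p y)"
    by (simp only: inverse_diff_inverse[OF nz] rat_pabs_minus rat_pabs_mult[OF p] rat_pabs_inverse[OF p])
       (simp add: divide_inverse mult_ac)
  also have "\<dots> \<le> rat_pabs p (x - y) / (b * c)"
    using assms by (intro divide_left_mono mult_mono mult_pos_pos) auto
  finally show ?thesis .
qed

lemma pcauchy_inverse:
  assumes p: "prime p" and X: "pcauchy p X" "\<not> pnull p X"
  shows "pcauchy p (\<lambda>n. inverse (X n))"
  unfolding pcauchy_def
proof (intro allI impI)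
  fix e :: real assume e: "e > 0"
  obtain b M where b: "b > 0" "\<And>n. n \<ge> M \<Longrightarrow> rat_pabs p (X n) > b"
    using pcauchy_not_null[OF assms] by blast
  have "e * (b * b) > 0" using e b by simp
  then obtain N where N: "\<forall>m\<ge>N. \<forall>n\<ge>N. rat_pabs p (X m - X n) < e * (b * b)" using X
    unfolding pcauchy_def by blast
  have "rat_pabs p (inverse (X m) - inverse (X n)) < e"
    if mn: "m \<ge> max M N" "n \<ge> max M N" for m n
  proof -
    have "rat_pabs p (inverse (X m) - inverse (X n)) \<le> rat_pabs p (X m - X n) / (b * b)"
      using b mn by (intro rat_pabs_inverse_diff[OF p]) auto
    also have "\<dots> < e" using N mn b by (simp add: pos_divide_less_eq)
    finally show ?thesis .
  qed
  then show "\<exists>M. \<forall>m\<ge>M. \<forall>n\<ge>M. rat_pabs p (inverse (X m) - inverse (X n)) < e" by blast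
qed

lemma pnull_diff_inverse:
  assumes p: "prime p" and X: "pcauchy p X" "\<not> pnull p X" and Y: "pcauchy p Y" "\<not> pnull p Y"
    and XY: "pnull p (\<lambda>n. X n - Y n)"
  shows "pnull p (\<lambda>n. inverse (X n) - inverse (Y n))"
proof -
  obtain b M where b: "b > 0" "\<And>n. n \<ge> M \<Longrightarrow> rat_pabs p (X n) > b"
    using pcauchy_not_null[OF p X] by blast
  obtain c N where c: "c > 0" "\<And>n. n \<ge> N \<Longrightarrow> rat_pabs p (Y n) > c"
    using pcauchy_not_null[OF p Y] by blast
  have ev: "eventually (\<lambda>n. rat_pabs p (inverse (X n) - inverse (Y n))
              \<le> rat_pabs p (X n - Y n) / (b * c)) sequentially"
    unfolding eventually_sequentially
    by (rule exI[of _ "max M N"]) (use b c rat_pabs_inverse_diff[OF p] in auto)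
  have "(\<lambda>n. rat_pabs p (X n - Y n) / (b * c)) \<longlonglongrightarrow> 0"
    using XY unfolding pnull_def by (rule tendsto_divide_zero)
  then show ?thesis unfolding pnull_def
    by (intro tendsto_sandwich[OF _ ev tendsto_const]) auto
qed


typedef (overloaded) 'p pcauchy_seq = "{X. pcauchy CARD('p::prime_card) X}"
  by (rule exI[of _ "\<lambda>_. 0"]) simp

setup_lifting type_definition_pcauchy_seq

instantiation pcauchy_seq :: (prime_card) comm_ring_1
begin

lift_definition zero_pcauchy_seq :: "'a pcauchy_seq" is "\<lambda>n. 0" by simp
lift_definition one_pcauchy_seq :: "'a pcauchy_seq" is "\<lambda>n. 1" by simp
lift_definition plus_pcauchy_seq :: "'a pcauchy_seq \<Rightarrow> 'a pcauchy_seq \<Rightarrow> 'a pcauchy_seq"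
  is "\<lambda>X Y n. X n + Y n" by (rule pcauchy_add[OF prime_card])
lift_definition uminus_pcauchy_seq :: "'a pcauchy_seq \<Rightarrow> 'a pcauchy_seq"
  is "\<lambda>X n. - X n" by (rule pcauchy_minus)
lift_definition minus_pcauchy_seq :: "'a pcauchy_seq \<Rightarrow> 'a pcauchy_seq \<Rightarrow> 'a pcauchy_seq"
  is "\<lambda>X Y n. X n - Y n"
  unfolding diff_conv_add_uminus by (intro pcauchy_add[OF prime_card] pcauchy_minus)
lift_definition times_pcauchy_seq :: "'a pcauchy_seq \<Rightarrow> 'a pcauchy_seq \<Rightarrow> 'a pcauchy_seq"
  is "\<lambda>X Y n. X n * Y n" by (rule pcauchy_mult[OF prime_card])

instance
  by (standard; transfer) (auto simp: algebra_simps fun_eq_iff)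

end

lift_definition null_seq :: "'p::prime_card pcauchy_seq \<Rightarrow> bool" is "pnull CARD('p)" .

lift_definition inverse_seq :: "'p::prime_card pcauchy_seq \<Rightarrow> 'p pcauchy_seq"
  is "\<lambda>X. if pnull CARD('p) X then (\<lambda>n. 0) else (\<lambda>n. inverse (X n))"
  by (auto intro: pcauchy_inverse[OF prime_card])

lift_definition norm_seq :: "'p::prime_card pcauchy_seq \<Rightarrow> real"
  is "\<lambda>X. lim (\<lambda>n. rat_pabs CARD('p) (X n))" .

lemma null_seq_0 [simp]: "null_seq 0"
  by transfer simp

lemma null_seq_minus: "null_seq X \<Longrightarrow> null_seq (- X)"
  by transfer (rule pnull_minus)

lemma null_seq_add: "null_seq X \<Longrightarrow> null_seq Y \<Longrightarrow> null_seq (X + Y)"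
  by transfer (rule pnull_add[OF prime_card])

lemma null_seq_mult: "null_seq Y \<Longrightarrow> null_seq (X * Y)"
  by transfer (rule pnull_mult[OF prime_card])

lemma not_null_seq_1: "\<not> null_seq 1"
  by transfer (simp add: pnull_def LIMSEQ_const_iff)

lemma null_seq_cong:
  assumes "null_seq (X - Y)"
  shows "null_seq X \<longleftrightarrow> null_seq Y"
  using null_seq_add[OF assms, of Y] null_seq_add[OF null_seq_minus[OF assms], of X] by auto

lemma null_seq_diff_inverse:
  "null_seq (X - Y) \<Longrightarrow> null_seq (inverse_seq X - inverse_seq Y)"
proof -
  assume XY: "null_seq (X - Y)"
  note iff = null_seq_cong[OF XY]
  show ?thesis
    using XY iff
    by transfer (auto intro: pnull_diff_inverse[OF prime_card])
qed

lemma null_seq_inverse: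
  fixes X :: "'p::prime_card pcauchy_seq"
  shows "\<not> null_seq X \<Longrightarrow> null_seq (inverse_seq X * X - 1)"
proof transfer
  fix X assume X: "pcauchy CARD('p) X" "\<not> pnull CARD('p) X"
  obtain b M where b: "b > 0" "\<And>n. n \<ge> M \<Longrightarrow> rat_pabs CARD('p) (X n) > b"
    using pcauchy_not_null[OF prime_card X] by blast
  have "eventually (\<lambda>n. rat_pabs CARD('p) (inverse (X n) * X n - 1) = 0) sequentially"
    unfolding eventually_sequentially
  proof (intro exI[of _ M] allI impI)
    fix n assume "n \<ge> M"
    then have "X n \<noteq> 0" using b by fastforce
    then show "rat_pabs CARD('p) (inverse (X n) * X n - 1) = 0" by simp
  qed
  then show "pnull CARD('p)
      (\<lambda>n. (if pnull CARD('p) X then \<lambda>n. 0 else (\<lambda>n. inverse (X n))) n * X n - 1)"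
    using X by (simp add: pnull_def tendsto_eventually)
qed

lemma norm_seq_tendsto:
  fixes X :: "'p::prime_card pcauchy_seq"
  shows "(\<lambda>n. rat_pabs CARD('p) (Rep_pcauchy_seq X n)) \<longlonglongrightarrow> norm_seq X"
  by transfer (use pcauchy_convergent[OF prime_card] convergent_LIMSEQ_iff in blast)

lemma norm_seq_null_iff: "norm_seq X = 0 \<longleftrightarrow> null_seq X"
  using norm_seq_tendsto[of X] unfolding null_seq.rep_eq pnull_def
  by (metis LIMSEQ_unique)

lemma norm_seq_triangle: "norm_seq (X + Y) \<le> norm_seq X + norm_seq Y"
  by (rule LIMSEQ_le[OF norm_seq_tendsto tendsto_add[OF norm_seq_tendsto norm_seq_tendsto]])
     (use rat_pabs_triangle[OF prime_card] in \<open>auto simp: plus_pcauchy_seq.rep_eq\<close>)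

lemma norm_seq_minus: "norm_seq (- X) = norm_seq X"
  by transfer simp

lemma norm_seq_cong:
  assumes "null_seq (X - Y)"
  shows "norm_seq X = norm_seq Y"
  using norm_seq_triangle[of "X - Y" Y] norm_seq_triangle[of "- (X - Y)" X]
    norm_seq_null_iff[of "X - Y"] assms norm_seq_minus[of "X - Y"] by simp

quotient_type (overloaded) 'p padic = "'p::prime_card pcauchy_seq" / "\<lambda>X Y. null_seq (X - Y)"
proof (rule equivpI)
  show "reflp (\<lambda>X Y. null_seq (X - Y))"
    by (simp add: reflp_def)
  show "symp (\<lambda>X Y. null_seq (X - Y))"
    by (metis (no_types, lifting) minus_diff_eq null_seq_minus sympI)
  show "transp (\<lambda>X Y. null_seq (X - Y))"
    by (rule transpI) (metis (no_types, lifting) add_diff_eq diff_add_cancel null_seq_add)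
qed

instantiation padic :: (prime_card) field
begin

lift_definition zero_padic :: "'a padic" is 0 .
lift_definition one_padic :: "'a padic" is 1 .
lift_definition plus_padic :: "'a padic \<Rightarrow> 'a padic \<Rightarrow> 'a padic" is "(+)"
  unfolding add_diff_add by (rule null_seq_add)
lift_definition uminus_padic :: "'a padic \<Rightarrow> 'a padic" is uminus
  unfolding minus_diff_minus by (rule null_seq_minus)
lift_definition minus_padic :: "'a padic \<Rightarrow> 'a padic \<Rightarrow> 'a padic" is "(-)"
  by (metis (no_types, lifting) add_diff_add diff_conv_add_uminus minus_diff_minus
        null_seq_add null_seq_minus)
lift_definition times_padic :: "'a padic \<Rightarrow> 'a padic \<Rightarrow> 'a padic" is "(*)"
  unfolding mult_diff_mult by (metis null_seq_add null_seq_mult mult.commute)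
lift_definition inverse_padic :: "'a padic \<Rightarrow> 'a padic" is inverse_seq
  by (rule null_seq_diff_inverse)
definition divide_padic :: "'a padic \<Rightarrow> 'a padic \<Rightarrow> 'a padic" where
  "divide_padic x y = x * inverse y"

instance
proof
  fix a b c :: "'a padic"
  show "a + b + c = a + (b + c)" by transfer (simp add: algebra_simps)
  show "a + b = b + a" by transfer (simp add: algebra_simps)
  show "0 + a = a" by transfer simp
  show "- a + a = 0" by transfer simp
  show "a - b = a + - b" by transfer simp
  show "a * b * c = a * (b * c)" by transfer (simp add: algebra_simps)
  show "a * b = b * a" by transfer (simp add: algebra_simps)
  show "1 * a = a" by transfer simp
  show "(a + b) * c = a * c + b * c" by transfer (simp add: algebra_simps)
  show "(0::'a padic) \<noteq> 1"
    by transfer (use null_seq_minus not_null_seq_1 in force)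
  show "a \<noteq> 0 \<Longrightarrow> inverse a * a = 1"
    by transfer (simp add: null_seq_inverse)
  show "a div b = a * inverse b" by (rule divide_padic_def)
  show "inverse 0 = (0::'a padic)"
    by transfer (transfer, simp)
qed

end

lift_definition padic_norm :: "'p::prime_card padic \<Rightarrow> real" is norm_seq
  by (rule norm_seq_cong)

instantiation padic :: (prime_card) metric_space
begin

definition dist_padic :: "'a padic \<Rightarrow> 'a padic \<Rightarrow> real" where
  "dist_padic x y = padic_norm (x - y)"

definition uniformity_padic :: "('a padic \<times> 'a padic) filter" where
  "uniformity_padic = (INF e\<in>{0<..}. principal {(x, y). dist x y < e})"

definition open_padic :: "'a padic set \<Rightarrow> bool" where
  "open_padic U \<longleftrightarrow> (\<forall>x\<in>U. eventually (\<lambda>(x', y). x' = x \<longrightarrow> y \<in> U) uniformity)"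

instance
proof
  fix x y z :: "'a padic"
  show "dist x y = 0 \<longleftrightarrow> x = y"
    unfolding dist_padic_def by transfer (rule norm_seq_null_iff)
  show "dist x y \<le> dist x z + dist y z"
    unfolding dist_padic_def
    by transfer (metis (no_types, lifting) diff_add_cancel diff_diff_eq2 minus_diff_eq
      add_diff_eq norm_seq_minus norm_seq_triangle)
qed (simp_all add: uniformity_padic_def open_padic_def)

end

lemma padic_norm_mult: "padic_norm (x * y) = padic_norm x * padic_norm y"
proof transfer
  fix X Y :: "'a pcauchy_seq"
  show "norm_seq (X * Y) = norm_seq X * norm_seq Y"
    using tendsto_mult[OF norm_seq_tendsto[of X] norm_seq_tendsto[of Y]] norm_seq_tendsto[of "X * Y"]
    by (simp add: times_pcauchy_seq.rep_eq rat_pabs_mult[OF prime_card] LIMSEQ_unique)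
qed

lemma Rep_pcauchy_seq_of_int: "Rep_pcauchy_seq (of_int a) = (\<lambda>n. of_int a)"
proof (induction a rule: int_induct[where k = 0])
  case base
  show ?case by (simp add: zero_pcauchy_seq.rep_eq)
next
  case (step1 i)
  then show ?case by (simp add: plus_pcauchy_seq.rep_eq one_pcauchy_seq.rep_eq)
next
  case (step2 i)
  then show ?case by (simp add: minus_pcauchy_seq.rep_eq one_pcauchy_seq.rep_eq)
qed

lemma of_int_padic: "of_int a = abs_padic (of_int a)"
proof (induction a rule: int_induct[where k = 0])
  case base
  show ?case by (simp add: zero_padic_def)
next
  case (step1 i)
  then show ?case by (simp add: plus_padic.abs_eq one_padic_def)
next
  case (step2 i)
  then show ?case by (simp add: minus_padic.abs_eq one_padic_def)
qed

lemma padic_norm_of_int: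
  "padic_norm (of_int a :: 'p::prime_card padic) = rat_pabs CARD('p) (of_int a)"
  unfolding of_int_padic padic_norm.abs_eq norm_seq.rep_eq Rep_pcauchy_seq_of_int by simp

definition padic_int :: "'p::prime_card padic set" where
  "padic_int = {a. padic_norm a \<le> 1}"

text \<open>\<open>of_int (to_int_mod_ring u)\<close> is an integer representative of the residue class \<open>u\<close>.\<close>

definition teichmueller :: "'p::prime_card mod_ring \<Rightarrow> 'p padic" where
  "teichmueller u = (THE t. t \<in> padic_int \<and> padic_norm (t - of_int (to_int_mod_ring u)) < 1
                             \<and> t ^ CARD('p) = t)"

definition residue_disc :: "'p::prime_card mod_ring \<Rightarrow> 'p padic set" where
  "residue_disc u = {a \<in> padic_int. padic_norm (a - teichmueller u) < 1}"

text \<open>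
  Analyticity on a union of residue discs. The coefficients of the power series are
  allowed to lie in the field \<open>'p padic\<close>.
\<close>

definition padic_analytic_on :: "'p::prime_card padic set \<Rightarrow> ('p padic \<Rightarrow> 'p padic) \<Rightarrow> bool" where
  "padic_analytic_on D f \<longleftrightarrow>
     (\<exists>R. D = (\<Union>u\<in>R. residue_disc u)) \<and>
     (\<forall>u. residue_disc u \<subseteq> D \<longrightarrow>
        (\<exists>c. \<forall>z\<in>residue_disc u. (\<lambda>m. c m * (z - teichmueller u) ^ m) sums f z))"


section \<open>Master polynomials and their coefficients\<close>

text \<open>
  Polynomials in the variables \<open>x\<^sub>i\<^sub>,\<^sub>j\<close>, indexed by pairs, with coefficients in \<open>\<int>[z]\<close>.
\<close>

type_synonym xzpoly = "((nat \<times> nat) \<Rightarrow>\<^sub>0 nat) \<Rightarrow>\<^sub>0 int poly"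

definition xvar :: "nat \<Rightarrow> nat \<Rightarrow> xzpoly" where
  "xvar i j = Poly_Mapping.single (Poly_Mapping.single (i, j) 1) 1"

definition zvar :: xzpoly where
  "zvar = Poly_Mapping.single 0 [:0, 1:]"

definition vdim :: "nat \<Rightarrow> nat \<Rightarrow> nat \<Rightarrow> nat" where
  "vdim n k i = (if i < k then i else if i \<le> n - k then k else n - i)"

definition Delta :: "nat \<Rightarrow> nat \<Rightarrow> xzpoly" where
  "Delta n k = (\<Prod>m=1..n-1. \<Prod>(i, j)\<in>{(i, j). 1 \<le> i \<and> i < j \<and> j \<le> vdim n k m}.
                  (xvar m j - xvar m i))"

text \<open>
  For \<open>p \<equiv> 1\<close> modulo \<open>q\<close> and \<open>2 * r \<le> q\<close> the divisions are exact and the subtractions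
  are not truncated.
\<close>

definition Phi_bar :: "nat \<Rightarrow> nat \<Rightarrow> nat \<Rightarrow> nat \<Rightarrow> nat \<Rightarrow> nat \<Rightarrow> xzpoly" where
  "Phi_bar n k r q p s =
     (\<Prod>i=1..n-1. \<Prod>j=1..vdim n k i. xvar i j) ^ ((p ^ s - 1) * (q - r) div q)
   * Delta n k ^ ((p ^ s - 1) * (q - 2 * r) div q)
   * (\<Prod>i=1..n-2. \<Prod>a=1..vdim n k i. \<Prod>b=1..vdim n k (i + 1). (xvar i a - xvar (i + 1) b))
       ^ ((p ^ s - 1) * r div q)
   * (\<Prod>i=1..k. (zvar - xvar k i) * (1 - xvar (n - k) i)) ^ ((p ^ s - 1) * r div q)"

definition Phi :: "nat \<Rightarrow> nat \<Rightarrow> nat \<Rightarrow> nat \<Rightarrow> nat \<Rightarrow> nat \<Rightarrow> xzpoly" where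
  "Phi n k r q p s = Delta n k * Phi_bar n k r q p s"

definition e_index :: "nat \<Rightarrow> nat \<Rightarrow> nat \<Rightarrow> int" where
  "e_index k i j = \<bar>int i - int k\<bar> + 2 * int j - 1"

definition N_exp :: "nat \<Rightarrow> nat \<Rightarrow> nat" where
  "N_exp n k = k + card {(i, a, b). 1 \<le> i \<and> i \<le> n - 2 \<and> 1 \<le> a \<and> a \<le> vdim n k i
                   \<and> 1 \<le> b \<and> b \<le> vdim n k (i + 1) \<and> e_index k i a < e_index k (i + 1) b}"

definition T_poly :: "nat \<Rightarrow> nat \<Rightarrow> nat \<Rightarrow> nat \<Rightarrow> nat \<Rightarrow> nat \<Rightarrow> int poly" where
  "T_poly n k r q p s =
     (if s = 0 then 1
      else (- 1) ^ ((p ^ s - 1) * r div q * N_exp n k)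
         * Poly_Mapping.lookup (Phi n k r q p s)
             (\<Sum>i=1..n-1. \<Sum>j=1..vdim n k i. Poly_Mapping.single (i, j) (j * p ^ s - 1)))"

definition T_fun :: "nat \<Rightarrow> nat \<Rightarrow> nat \<Rightarrow> nat \<Rightarrow> nat \<Rightarrow> 'p::prime_card padic \<Rightarrow> 'p padic" where
  "T_fun n k r q s a = poly (map_poly of_int (T_poly n k r q CARD('p) s)) a"

definition D_set :: "nat \<Rightarrow> nat \<Rightarrow> nat \<Rightarrow> nat \<Rightarrow> 'p::prime_card padic set" where
  "D_set n k r q = {a \<in> padic_int. padic_norm (T_fun n k r q 1 a) = 1}"

definition I_fun :: "nat \<Rightarrow> nat \<Rightarrow> nat \<Rightarrow> nat \<Rightarrow> nat \<Rightarrow> 'p::prime_card padic \<Rightarrow> 'p padic" where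
  "I_fun n k r q s a = T_fun n k r q (s + 1) a / T_fun n k r q s (a ^ CARD('p))"

end

theory Submission
  imports Defs
begin

text \<open>
  Let \<open>F\<close> be the signed polynomial \<open>\<Phi>\<^sub>1 / \<Delta>\<close>. Then \<open>\<Phi>\<^sub>s / \<Delta>\<close> is, up to the sign in \<open>T\<^sub>s\<close>, the product of
  the powers \<open>F ^ p ^ m\<close> with \<open>m < s\<close>. With the Frobenius lift \<open>\<sigma>\<close> that raises \<open>z\<close> and all \<open>x\<^sub>i\<^sub>,\<^sub>j\<close> to the
  \<open>p\<close>-th power, \<open>F ^ p ^ m\<close> is a sum of ghost terms \<open>\<sigma> ^ (m - i) R\<^sub>i\<close> with \<open>p ^ i\<close> dividing \<open>R\<^sub>i\<close>.

  The polynomial \<open>F\<close> is symmetric in each group of variables and has degree less than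
  \<open>(p - 1) (v\<^sub>i + 1)\<close> in \<open>x\<^sub>i\<^sub>,\<^sub>j\<close>. Hence the exponents in \<open>(\<Prod>x) \<Delta> F \<dots> F ^ p ^ (s - 1)\<close> that are divisible by \<open>p ^ s\<close>
  are, by antisymmetry, \<open>p ^ s\<close> times permutations of \<open>1, \<dots>, v\<^sub>i\<close> in each group, so that extracting the
  coefficient \<open>T\<^sub>s\<close> is multiplicative. This turns the ghost expansion into a recursion
  \<open>T\<^sub>s\<^sub>+\<^sub>1 = (\<Sum>n\<le>s. T\<^sub>s\<^sub>-\<^sub>n \<sigma> ^ (s - n) (G\<^sub>n))\<close> with \<open>p ^ n\<close> dividing \<open>G\<^sub>n\<close>, which implies the Dwork congruences
  \<open>T\<^sub>s\<^sub>+\<^sub>2 \<sigma>(T\<^sub>s) \<equiv> T\<^sub>s\<^sub>+\<^sub>1 \<sigma>(T\<^sub>s\<^sub>+\<^sub>1)\<close> modulo \<open>p ^ (s + 1)\<close>. They hold for polynomials, so both the values of the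
  \<open>I\<^sub>s\<close> and the coefficients of their expansions on a residue disc converge uniformly.
\<close>

section \<open>Dwork congruences from a Frobenius lift\<close>

lemma prime_dvd_add_power:
  fixes x y :: "'a::comm_ring_1"
  assumes p: "prime p"
  shows "of_nat p dvd (x + y) ^ p - (x ^ p + y ^ p)"
proof -
  have p0: "p > 0" using p prime_gt_0_nat by blast
  have "(x + y) ^ p = (\<Sum>k\<le>p. of_nat (p choose k) * x ^ k * y ^ (p - k))"
    by (rule binomial_ring)
  also have "{..p} = insert 0 (insert p {1..<p})" using p0 by auto
  also have "(\<Sum>k\<in>\<dots>. of_nat (p choose k) * x ^ k * y ^ (p - k))
      = x ^ p + y ^ p + (\<Sum>k\<in>{1..<p}. of_nat (p choose k) * x ^ k * y ^ (p - k))"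
    using p0 by (simp add: algebra_simps)
  finally have eq: "(x + y) ^ p - (x ^ p + y ^ p) =
      (\<Sum>k\<in>{1..<p}. of_nat (p choose k) * x ^ k * y ^ (p - k))" by simp
  have "of_nat p dvd (of_nat (p choose k) * x ^ k * y ^ (p - k) :: 'a)" if "k \<in> {1..<p}" for k
  proof -
    have "p dvd (p choose k)" using that p by (intro dvd_choose_prime) auto
    then have "(of_nat p :: 'a) dvd of_nat (p choose k)" by (metis dvd_def of_nat_mult)
    then show ?thesis by (simp add: dvd_mult2 mult.assoc)
  qed
  then show ?thesis unfolding eq by (intro dvd_sum) auto
qed

lemma power_prime_congruence:
  fixes x y :: "'a::comm_ring_1"
  assumes p: "prime p" and "m > 0" and d: "of_nat p ^ m dvd x - y"
  shows "of_nat p ^ Suc m dvd x ^ p - y ^ p"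
proof -
  have p0: "p > 0" using p prime_gt_0_nat by blast
  obtain c where c: "x - y = of_nat p ^ m * c" using d by (auto simp: dvd_def)
  have pd: "(of_nat p :: 'a) dvd of_nat p ^ m" using \<open>m > 0\<close> by (simp add: dvd_power)
  then have xy: "of_nat p dvd x - y" using d dvd_trans by blast
  have "of_nat p dvd (\<Sum>i<p. x ^ i * y ^ (p - Suc i) - y ^ (p - 1))"
  proof (intro dvd_sum)
    fix i assume i: "i \<in> {..<p}"
    then have "x ^ i * y ^ (p - Suc i) - y ^ (p - 1) = (x ^ i - y ^ i) * y ^ (p - Suc i)"
      by (auto simp: algebra_simps simp flip: power_add)
    moreover have "x - y dvd x ^ i - y ^ i" by (metis dvd_triv_left power_diff_sumr2)
    ultimately show "of_nat p dvd x ^ i * y ^ (p - Suc i) - y ^ (p - 1)"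
      using xy by (metis dvd_mult2 dvd_trans)
  qed
  then have "of_nat p dvd (\<Sum>i<p. x ^ i * y ^ (p - Suc i)) - of_nat p * y ^ (p - 1)"
    by (simp add: sum_subtractf)
  then have "of_nat p dvd (\<Sum>i<p. x ^ i * y ^ (p - Suc i))"
    by (metis dvd_diffD dvd_triv_left diff_add_cancel dvd_add)
  moreover have "x ^ p - y ^ p = (x - y) * (\<Sum>i<p. x ^ i * y ^ (p - Suc i))"
    by (simp add: power_diff_sumr2 mult.commute)
  ultimately show ?thesis unfolding c by (simp add: mult_dvd_mono mult.commute[of "of_nat p"] c d)
qed

locale frobenius_lift =
  fixes p :: nat and \<sigma> :: "'a::comm_ring_1 \<Rightarrow> 'a"
  assumes prime: "prime p"
    and lift_1: "\<sigma> 1 = 1"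
    and lift_add: "\<sigma> (x + y) = \<sigma> x + \<sigma> y"
    and lift_mult: "\<sigma> (x * y) = \<sigma> x * \<sigma> y"
    and lift_cong: "of_nat p dvd x ^ p - \<sigma> x"
begin

lemma lift_0: "\<sigma> 0 = 0"
  using lift_add[of 0 0] by simp

lemma lift_sum: "\<sigma> (sum f A) = (\<Sum>x\<in>A. \<sigma> (f x))"
  by (induction A rule: infinite_finite_induct) (auto simp: lift_0 lift_add)

lemma lift_power: "\<sigma> (x ^ n) = \<sigma> x ^ n"
  by (induction n) (auto simp: lift_1 lift_mult)

lemma lift_of_nat: "\<sigma> (of_nat n) = of_nat n"
  by (induction n) (auto simp: lift_0 lift_1 lift_add)

lemma iterate_1: "(\<sigma> ^^ n) 1 = 1"
  by (induction n) (auto simp: lift_1)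

lemma iterate_0: "(\<sigma> ^^ n) 0 = 0"
  by (induction n) (auto simp: lift_0)

lemma iterate_add: "(\<sigma> ^^ n) (x + y) = (\<sigma> ^^ n) x + (\<sigma> ^^ n) y"
  by (induction n) (auto simp: lift_add)

lemma iterate_mult: "(\<sigma> ^^ n) (x * y) = (\<sigma> ^^ n) x * (\<sigma> ^^ n) y"
  by (induction n) (auto simp: lift_mult)

lemma iterate_sum: "(\<sigma> ^^ n) (sum f A) = (\<Sum>x\<in>A. (\<sigma> ^^ n) (f x))"
  by (induction n) (auto simp: lift_sum)

lemma iterate_p_power_mult: "(\<sigma> ^^ n) (of_nat p ^ m * x) = of_nat p ^ m * (\<sigma> ^^ n) x"
  by (induction n) (auto simp: lift_mult lift_power lift_of_nat)

lemma iterate_dvd: "of_nat p ^ m dvd x \<Longrightarrow> of_nat p ^ m dvd (\<sigma> ^^ n) x"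
  by (metis dvd_def iterate_p_power_mult)

lemma lift_cong_power: "of_nat p ^ Suc m dvd x ^ p ^ Suc m - \<sigma> (x ^ p ^ m)"
proof (induction m)
  case 0
  then show ?case using lift_cong by simp
next
  case (Suc m)
  then have "of_nat p ^ Suc (Suc m) dvd (x ^ p ^ Suc m) ^ p - (\<sigma> (x ^ p ^ m)) ^ p"
    by (intro power_prime_congruence prime) auto
  then show ?case by (simp add: lift_power mult.commute flip: power_mult)
qed

text \<open>The ghost terms: \<open>x ^ p ^ m = (\<Sum>i\<le>m. \<sigma>\<^sup>m\<^sup>-\<^sup>i (ghost x i))\<close>, and \<open>p\<^sup>i\<close> divides \<open>ghost x i\<close>.\<close>

definition ghost :: "'a \<Rightarrow> nat \<Rightarrow> 'a" where
  "ghost x m = (if m = 0 then x else x ^ p ^ m - \<sigma> (x ^ p ^ (m - 1)))"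

lemma ghost_dvd: "of_nat p ^ m dvd ghost x m"
  using lift_cong_power[of "m - 1" x] by (cases m) (auto simp: ghost_def)

lemma power_ghost:
  "x ^ p ^ (i + s) = (\<sigma> ^^ s) (x ^ p ^ i) + (\<Sum>d\<in>{1..s}. (\<sigma> ^^ (s - d)) (ghost x (i + d)))"
proof (induction s)
  case 0
  then show ?case by simp
next
  case (Suc s)
  have "x ^ p ^ (i + Suc s) = \<sigma> (x ^ p ^ (i + s)) + ghost x (i + Suc s)"
    by (simp add: ghost_def)
  also have "\<sigma> (x ^ p ^ (i + s)) = (\<sigma> ^^ Suc s) (x ^ p ^ i)
      + (\<Sum>d\<in>{1..s}. (\<sigma> ^^ (Suc s - d)) (ghost x (i + d)))"
    unfolding Suc lift_add lift_sum
    by (auto simp: Suc_diff_le intro!: sum.cong)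
  finally show ?case by (simp add: add.assoc)
qed

definition partial_prod :: "'a \<Rightarrow> nat \<Rightarrow> 'a" where
  "partial_prod x s = (\<Prod>m<s. x ^ p ^ m)"

lemma partial_prod_Suc: "partial_prod x (Suc s) = partial_prod x s * x ^ p ^ s"
  by (simp add: partial_prod_def)

text \<open>
  In the skew power series ring with \<open>t * a = \<sigma> a * t\<close>, the series
  \<open>\<Sum>s. partial_prod x (s + i) * t ^ s\<close> is the series \<open>\<Sum>s. partial_prod x s * t ^ s\<close>
  times \<open>\<Sum>n. dwork_coeff x i n * t ^ n\<close>.
\<close>

fun dwork_coeff :: "'a \<Rightarrow> nat \<Rightarrow> nat \<Rightarrow> 'a" where
  "dwork_coeff x 0 n = (if n = 0 then 1 else 0)"
| "dwork_coeff x (Suc i) n = dwork_coeff x i n * (\<sigma> ^^ n) (x ^ p ^ i)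
     + (\<Sum>d\<in>{1..n}. dwork_coeff x (i + d) (n - d) * (\<sigma> ^^ (n - d)) (ghost x (i + d)))"

lemma dwork_coeff_dvd: "of_nat p ^ n dvd dwork_coeff x i n"
proof (induction x i n rule: dwork_coeff.induct)
  case (1 x n)
  then show ?case by simp
next
  case (2 x i n)
  have "of_nat p ^ n dvd dwork_coeff x (i + d) (n - d) * (\<sigma> ^^ (n - d)) (ghost x (i + d))"
    if d: "d \<in> {1..n}" for d
  proof -
    have "(of_nat p :: 'a) ^ (n - d) * of_nat p ^ (i + d)
        dvd dwork_coeff x (i + d) (n - d) * (\<sigma> ^^ (n - d)) (ghost x (i + d))"
      using 2(2) d by (intro mult_dvd_mono iterate_dvd ghost_dvd) auto
    moreover have "(n - d) + (i + d) = n + i" using d by auto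
    ultimately have "(of_nat p :: 'a) ^ (n + i)
        dvd dwork_coeff x (i + d) (n - d) * (\<sigma> ^^ (n - d)) (ghost x (i + d))"
      by (metis power_add)
    then show ?thesis by (metis dvd_mult_left power_add)
  qed
  then show ?case using 2(1) by (auto intro!: dvd_add dvd_sum)
qed

lemma partial_prod_expansion:
  "partial_prod x (s + i) =
     (\<Sum>n\<le>s. partial_prod x (s - n) * (\<sigma> ^^ (s - n)) (dwork_coeff x i n))"
proof (induction "(s, i)" arbitrary: s i rule: wf_induct_rule[OF wf_lex_prod[OF wf_less_than wf_less_than]])
  case 1
  note IH = 1
  show ?case
  proof (cases i)
    case 0
    have "(\<Sum>n\<le>s. partial_prod x (s - n) * (\<sigma> ^^ (s - n)) (dwork_coeff x 0 n))
        = (\<Sum>n\<in>{0}. partial_prod x (s - n) * (\<sigma> ^^ (s - n)) (dwork_coeff x 0 n))"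
      by (rule sum.mono_neutral_right) (auto simp: iterate_0)
    then show ?thesis using 0 by (simp add: iterate_1)
  next
    case (Suc j)
    have 1: "partial_prod x (s + j) =
       (\<Sum>n\<le>s. partial_prod x (s - n) * (\<sigma> ^^ (s - n)) (dwork_coeff x j n))"
      using IH[of s j] Suc by auto
    have A: "partial_prod x (s + j) * (\<sigma> ^^ s) (x ^ p ^ j) =
       (\<Sum>n\<le>s. partial_prod x (s - n) * (\<sigma> ^^ (s - n)) (dwork_coeff x j n * (\<sigma> ^^ n) (x ^ p ^ j)))"
      unfolding 1 sum_distrib_right
    proof (intro sum.cong refl)
      fix n assume "n \<in> {..s}"
      then have "(\<sigma> ^^ (s - n)) ((\<sigma> ^^ n) (x ^ p ^ j)) = (\<sigma> ^^ s) (x ^ p ^ j)"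
        by (metis atMost_iff funpow_add le_add_diff_inverse2 o_apply)
      then show "partial_prod x (s - n) * (\<sigma> ^^ (s - n)) (dwork_coeff x j n) * (\<sigma> ^^ s) (x ^ p ^ j) =
        partial_prod x (s - n) * (\<sigma> ^^ (s - n)) (dwork_coeff x j n * (\<sigma> ^^ n) (x ^ p ^ j))"
        by (simp add: iterate_mult mult.assoc)
    qed
    define g where "g n d = partial_prod x (s - n) * (\<sigma> ^^ (s - n))
         (dwork_coeff x (j + d) (n - d) * (\<sigma> ^^ (n - d)) (ghost x (j + d)))" for n d
    have B: "partial_prod x (s + j) * (\<sigma> ^^ (s - d)) (ghost x (j + d)) = (\<Sum>n\<in>{d..s}. g n d)"
      if d: "d \<in> {1..s}" for d
    proof -
      have "partial_prod x ((s - d) + (j + d)) =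
         (\<Sum>n\<le>s - d. partial_prod x (s - d - n) * (\<sigma> ^^ (s - d - n)) (dwork_coeff x (j + d) n))"
        using d by (intro IH) auto
      also have "(s - d) + (j + d) = s + j" using d by auto
      finally have "partial_prod x (s + j) * (\<sigma> ^^ (s - d)) (ghost x (j + d)) =
        (\<Sum>n\<le>s - d. partial_prod x (s - d - n) * (\<sigma> ^^ (s - d - n)) (dwork_coeff x (j + d) n)
           * (\<sigma> ^^ (s - d)) (ghost x (j + d)))"
        by (simp add: sum_distrib_right)
      also have "\<dots> = (\<Sum>n\<le>s - d. g (n + d) d)"
      proof (intro sum.cong refl)
        fix n assume n: "n \<in> {..s - d}"
        then have "(\<sigma> ^^ (s - d - n)) ((\<sigma> ^^ n) (ghost x (j + d))) = (\<sigma> ^^ (s - d)) (ghost x (j + d))"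
          by (metis atMost_iff funpow_add le_add_diff_inverse2 o_apply)
        then show "partial_prod x (s - d - n) * (\<sigma> ^^ (s - d - n)) (dwork_coeff x (j + d) n)
           * (\<sigma> ^^ (s - d)) (ghost x (j + d)) = g (n + d) d"
          by (simp add: g_def iterate_mult mult.assoc add.commute)
      qed
      also have "\<dots> = (\<Sum>n\<in>{d..s}. g n d)"
        using d by (intro sum.reindex_bij_witness[of _ "\<lambda>n. n - d" "\<lambda>n. n + d"]) auto
      finally show ?thesis .
    qed
    have "partial_prod x (s + i) = partial_prod x (s + j) * x ^ p ^ (j + s)"
      using Suc by (simp add: partial_prod_Suc add.commute)
    also have "\<dots> = partial_prod x (s + j) * (\<sigma> ^^ s) (x ^ p ^ j)
        + (\<Sum>d\<in>{1..s}. partial_prod x (s + j) * (\<sigma> ^^ (s - d)) (ghost x (j + d)))"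
      unfolding power_ghost by (simp add: distrib_left sum_distrib_left)
    also have "(\<Sum>d\<in>{1..s}. partial_prod x (s + j) * (\<sigma> ^^ (s - d)) (ghost x (j + d)))
        = (\<Sum>d\<in>{1..s}. \<Sum>n\<in>{d..s}. g n d)"
      using B by (rule sum.cong[OF refl])
    also have "\<dots> = (\<Sum>n\<le>s. \<Sum>d\<in>{1..n}. g n d)"
      unfolding sum.Sigma[OF finite_atLeastAtMost ballI[OF finite_atLeastAtMost]]
        sum.Sigma[OF finite_atMost ballI[OF finite_atLeastAtMost]]
      by (rule sum.reindex_bij_witness[of _ prod.swap prod.swap]) auto
    finally show ?thesis unfolding A Suc dwork_coeff.simps g_def
      by (simp add: iterate_add iterate_sum distrib_left sum_distrib_left sum.distrib)
  qed
qed

lemma dwork_congruence: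
  assumes rec: "\<And>s. T (Suc s) = (\<Sum>n\<le>s. T (s - n) * (\<sigma> ^^ (s - n)) (G n))"
    and G: "\<And>n. of_nat p ^ n dvd G n"
  shows "a \<le> b \<Longrightarrow> of_nat p ^ Suc a dvd T (Suc b) * \<sigma> (T a) - T (Suc a) * \<sigma> (T b)"
proof (induction b arbitrary: a rule: less_induct)
  case (less b)
  show ?case
  proof (cases "a = b")
    case True
    then show ?thesis by (simp add: mult.commute)
  next
    case False
    then have ab: "a < b" using less.prems by simp
    then obtain b' where b': "b = Suc b'" by (cases b) auto
    have "\<sigma> (T b) = (\<Sum>n\<le>b'. \<sigma> (T (b' - n)) * (\<sigma> ^^ (b - n)) (G n))"
      unfolding b' rec lift_sum lift_mult by (intro sum.cong refl) (simp add: Suc_diff_le)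
    then have "T (Suc b) * \<sigma> (T a) - T (Suc a) * \<sigma> (T b) =
      (\<Sum>n\<le>b'. T (b - n) * (\<sigma> ^^ (b - n)) (G n)) * \<sigma> (T a) + T 0 * G b * \<sigma> (T a)
        - T (Suc a) * (\<Sum>n\<le>b'. \<sigma> (T (b' - n)) * (\<sigma> ^^ (b - n)) (G n))"
      unfolding rec[of b] by (simp add: b' algebra_simps)
    also have "\<dots> = (\<Sum>n\<le>b'. (T (Suc (b' - n)) * \<sigma> (T a) - T (Suc a) * \<sigma> (T (b' - n)))
        * (\<sigma> ^^ (b - n)) (G n)) + G b * (T 0 * \<sigma> (T a))"
      unfolding sum_distrib_left sum_distrib_right
      by (simp add: b' Suc_diff_le algebra_simps sum_subtractf)
    also have "of_nat p ^ Suc a dvd \<dots>"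
    proof (intro dvd_add dvd_sum)
      show "of_nat p ^ Suc a dvd G b * (T 0 * \<sigma> (T a))"
        using G[of b] ab by (meson Suc_leI dvd_mult2 dvd_trans le_imp_power_dvd)
    next
      fix n assume n: "n \<in> {..b'}"
      show "of_nat p ^ Suc a dvd (T (Suc (b' - n)) * \<sigma> (T a) - T (Suc a) * \<sigma> (T (b' - n)))
        * (\<sigma> ^^ (b - n)) (G n)"
      proof (cases "a \<le> b' - n")
        case True
        then show ?thesis using less.IH[of "b' - n" a] by (auto simp: b')
      next
        case False
        then have "of_nat p ^ Suc (b' - n) dvd T (Suc a) * \<sigma> (T (b' - n)) - T (Suc (b' - n)) * \<sigma> (T a)"
          using less.IH[of a "b' - n"] ab by auto
        then have "of_nat p ^ Suc (b' - n) dvd T (Suc (b' - n)) * \<sigma> (T a) - T (Suc a) * \<sigma> (T (b' - n))"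
          by (metis dvd_minus_iff minus_diff_eq)
        then have "of_nat p ^ Suc (b' - n) * of_nat p ^ n
            dvd (T (Suc (b' - n)) * \<sigma> (T a) - T (Suc a) * \<sigma> (T (b' - n))) * (\<sigma> ^^ (b - n)) (G n)"
          by (intro mult_dvd_mono iterate_dvd G)
        moreover have "Suc (b' - n) + n = b" using n b' by auto
        ultimately show ?thesis using ab
          by (metis Suc_leI dvd_trans le_imp_power_dvd power_add)
      qed
    qed
    finally show ?thesis .
  qed
qed

end

section \<open>Coefficients of alternating polynomials\<close>

subsection \<open>Frobenius lifts on polynomials\<close>

lemma frobenius_cong_add:
  fixes x y :: "'a::comm_ring_1"
  assumes "prime p" "of_nat p dvd x ^ p - x'" "of_nat p dvd y ^ p - y'"
  shows "of_nat p dvd (x + y) ^ p - (x' + y')"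
proof -
  have "(x + y) ^ p - (x' + y') = ((x + y) ^ p - (x ^ p + y ^ p)) + ((x ^ p - x') + (y ^ p - y'))"
    by simp
  then show ?thesis using prime_dvd_add_power[OF assms(1), of x y] assms(2,3) by (metis dvd_add)
qed

lemma frobenius_cong_mult:
  fixes x y :: "'a::comm_ring_1"
  assumes "of_nat p dvd x ^ p - x'" "of_nat p dvd y ^ p - y'"
  shows "of_nat p dvd (x * y) ^ p - x' * y'"
proof -
  have "(x * y) ^ p - x' * y' = x ^ p * (y ^ p - y') + (x ^ p - x') * y'"
    by (simp add: algebra_simps)
  then show ?thesis using assms by (metis dvd_add dvd_mult dvd_mult2)
qed

lemma frobenius_lift_int: "prime p \<Longrightarrow> frobenius_lift p (\<lambda>a::int. a)"
proof (unfold_locales, simp_all)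
  fix x :: int
  assume p: "prime p"
  then have p0: "p > 0" using prime_gt_0_nat by blast
  have add: "int p dvd (a + b) ^ p - (a + b)" if "int p dvd a ^ p - a" "int p dvd b ^ p - b" for a b
    using dvd_add[OF prime_dvd_add_power[OF p, of a b] dvd_add[OF that]] by (simp add: algebra_simps)
  have n: "int p dvd int n ^ p - int n" for n
    using p0 by (induction n) (auto simp: power_0_left dest: add[of 1, simplified])
  show "int p dvd x ^ p - x"
    using n[of "nat (x mod int p)"] p0
    by (simp add: mod_eq_dvd_iff[symmetric] power_mod)
qed

definition poly_frob :: "nat \<Rightarrow> int poly \<Rightarrow> int poly" where
  "poly_frob p f = pcompose f (Polynomial.monom 1 p)"

lemma frobenius_lift_poly_frob:
  assumes p: "prime p"
  shows "frobenius_lift p (poly_frob p)"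
proof
  fix f g :: "int poly"
  show "prime p" by fact
  show "poly_frob p 1 = 1" by (simp add: poly_frob_def pcompose_1)
  show "poly_frob p (f + g) = poly_frob p f + poly_frob p g" by (simp add: poly_frob_def pcompose_add)
  show "poly_frob p (f * g) = poly_frob p f * poly_frob p g" by (simp add: poly_frob_def pcompose_mult)
  show "of_nat p dvd f ^ p - poly_frob p f"
  proof (induction f)
    case 0
    then show ?case using prime_gt_0_nat[OF p] by (simp add: poly_frob_def power_0_left)
  next
    case (pCons c f)
    interpret Z: frobenius_lift p "\<lambda>a::int. a" by (rule frobenius_lift_int[OF p])
    obtain d where d: "c ^ p - c = int p * d" using Z.lift_cong[of c] by (auto simp: dvd_def)
    have "[:c:] ^ p - [:c:] = of_nat p * [:d:]"
      using d by (simp add: poly_const_pow of_nat_poly)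
    then have 1: "of_nat p dvd [:c:] ^ p - [:c:]" by (rule dvdI)
    have 2: "of_nat p dvd [:0, 1:] ^ p - (Polynomial.monom 1 p :: int poly)"
      by (simp add: monom_altdef)
    have "of_nat p dvd ([:c:] + [:0, 1:] * f) ^ p - ([:c:] + Polynomial.monom 1 p * poly_frob p f)"
      by (intro frobenius_cong_add[OF p 1] frobenius_cong_mult[OF 2] pCons)
    moreover have "[:c:] + [:0, 1:] * f = pCons c f" by simp
    moreover have "poly_frob p (pCons c f) = [:c:] + Polynomial.monom 1 p * poly_frob p f"
      by (simp add: poly_frob_def pcompose_pCons)
    ultimately show ?case by simp
  qed
qed

subsection \<open>Homomorphisms acting on monomials and coefficients\<close>

lemma poly_mapping_decompose:
  fixes f :: "'a \<Rightarrow>\<^sub>0 'b::comm_monoid_add"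
  shows "f = (\<Sum>m\<in>Poly_Mapping.keys f. Poly_Mapping.single m (Poly_Mapping.lookup f m))"
  by (rule poly_mapping_eqI) (auto simp: lookup_sum lookup_single when_def in_keys_iff sum.delta)

lemma poly_mapping_single_add_induct:
  fixes f :: "'a \<Rightarrow>\<^sub>0 'b::comm_monoid_add"
  assumes single: "\<And>m c. Q (Poly_Mapping.single m c)" and add: "\<And>f g. Q f \<Longrightarrow> Q g \<Longrightarrow> Q (f + g)"
  shows "Q f"
proof -
  have "Q (\<Sum>m\<in>S. Poly_Mapping.single m (Poly_Mapping.lookup f m))" if "finite S" for S
    using that
  proof (induction S rule: finite_induct)
    case empty
    then show ?case using single[of undefined 0] by simp
  qed (auto intro: single add)
  from this[of "Poly_Mapping.keys f"] show ?thesis by (simp flip: poly_mapping_decompose)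
qed

definition pm_hom :: "('a \<Rightarrow> 'a) \<Rightarrow> ('b \<Rightarrow> 'b) \<Rightarrow> ('a \<Rightarrow>\<^sub>0 'b) \<Rightarrow> ('a \<Rightarrow>\<^sub>0 'b::comm_monoid_add)" where
  "pm_hom g h f = (\<Sum>m\<in>Poly_Mapping.keys f. Poly_Mapping.single (g m) (h (Poly_Mapping.lookup f m)))"

locale monomial_hom =
  fixes g :: "'a::comm_monoid_add \<Rightarrow> 'a" and h :: "'b::comm_ring_1 \<Rightarrow> 'b"
  assumes g_inj: "inj g" and g_0: "g 0 = 0" and g_add: "g (m + m') = g m + g m'"
    and h_1: "h 1 = 1" and h_add: "h (c + d) = h c + h d" and h_mult: "h (c * d) = h c * h d"
begin

lemma h_0: "h 0 = 0"
  using h_add[of 0 0] by simp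

lemma h_minus: "h (- c) = - h c"
  using h_add[of c "- c"] h_0 by (simp add: eq_neg_iff_add_eq_0 add.commute)

lemma lookup_pm_hom: "Poly_Mapping.lookup (pm_hom g h f) (g m) = h (Poly_Mapping.lookup f m)"
  using g_inj by (auto simp: pm_hom_def lookup_sum lookup_single when_def inj_eq in_keys_iff h_0 sum.delta)

lemma lookup_pm_hom_notin: "n \<notin> range g \<Longrightarrow> Poly_Mapping.lookup (pm_hom g h f) n = 0"
  by (auto simp: pm_hom_def lookup_sum lookup_single when_def intro!: sum.neutral)

lemma pm_hom_eqI:
  assumes "\<And>m. Poly_Mapping.lookup F (g m) = h (Poly_Mapping.lookup f m)"
    and "\<And>n. n \<notin> range g \<Longrightarrow> Poly_Mapping.lookup F n = 0"
  shows "pm_hom g h f = F"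
  by (rule poly_mapping_eqI) (metis assms lookup_pm_hom lookup_pm_hom_notin rangeE)

lemma keys_pm_hom: "Poly_Mapping.keys (pm_hom g h f) \<subseteq> g ` Poly_Mapping.keys f"
proof
  fix n assume "n \<in> Poly_Mapping.keys (pm_hom g h f)"
  then have n: "Poly_Mapping.lookup (pm_hom g h f) n \<noteq> 0" by (simp add: in_keys_iff)
  then obtain m where "n = g m" using lookup_pm_hom_notin by blast
  then show "n \<in> g ` Poly_Mapping.keys f" using n by (metis h_0 imageI in_keys_iff lookup_pm_hom)
qed

lemma pm_hom_single: "pm_hom g h (Poly_Mapping.single m c) = Poly_Mapping.single (g m) (h c)"
  by (rule pm_hom_eqI) (use g_inj in \<open>auto simp: lookup_single when_def h_0 inj_eq\<close>)

lemma pm_hom_1: "pm_hom g h 1 = 1"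
  using pm_hom_single[of 0 1] by (simp add: g_0 h_1)

lemma pm_hom_add: "pm_hom g h (x + y) = pm_hom g h x + pm_hom g h y"
  by (rule pm_hom_eqI) (simp_all add: lookup_add lookup_pm_hom lookup_pm_hom_notin h_add)

lemma pm_hom_minus: "pm_hom g h (- x) = - pm_hom g h x"
  by (rule pm_hom_eqI) (simp_all add: lookup_pm_hom lookup_pm_hom_notin h_minus)

lemma pm_hom_diff: "pm_hom g h (x - y) = pm_hom g h x - pm_hom g h y"
  using pm_hom_add[of x "- y"] pm_hom_minus[of y] by simp

lemma pm_hom_mult: "pm_hom g h (x * y) = pm_hom g h x * pm_hom g h y"
proof (induction x rule: poly_mapping_single_add_induct)
  case (1 m c)
  show ?case
    by (induction y rule: poly_mapping_single_add_induct)
       (auto simp: mult_single pm_hom_single g_add h_mult distrib_left pm_hom_add)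
qed (auto simp: distrib_right pm_hom_add)

lemma pm_hom_power: "pm_hom g h (x ^ n) = pm_hom g h x ^ n"
  by (induction n) (auto simp: pm_hom_1 pm_hom_mult)

lemma pm_hom_prod: "pm_hom g h (prod f S) = (\<Prod>x\<in>S. pm_hom g h (f x))"
  by (induction S rule: infinite_finite_induct) (auto simp: pm_hom_1 pm_hom_mult)

end

lift_definition scale_mono :: "nat \<Rightarrow> ('v \<Rightarrow>\<^sub>0 nat) \<Rightarrow> ('v \<Rightarrow>\<^sub>0 nat)" is "\<lambda>c m x. c * m x"
  by (auto elim: finite_subset[rotated])

lemma scale_mono_0 [simp]: "scale_mono c 0 = 0"
  by transfer simp

lemma scale_mono_1 [simp]: "scale_mono (Suc 0) = (\<lambda>m. m)"
  by (rule ext, transfer) simp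

lemma scale_mono_add: "scale_mono c (m + n) = scale_mono c m + scale_mono c n"
  by transfer (simp add: distrib_left)

lemma scale_mono_scale_mono: "scale_mono c (scale_mono d m) = scale_mono (c * d) m"
  by transfer (simp add: mult.assoc)

lemma inj_scale_mono: "c > 0 \<Longrightarrow> inj (scale_mono c)"
  by (rule injI) (auto simp: poly_mapping_eq_iff scale_mono.rep_eq fun_eq_iff)

lemma power_single: "Poly_Mapping.single m c ^ n = Poly_Mapping.single (scale_mono n m) (c ^ n)"
proof (induction n)
  case 0
  have "scale_mono 0 m = 0" by transfer simp
  then show ?case by simp
next
  case (Suc n)
  have "m + scale_mono n m = scale_mono (Suc n) m" by transfer simp
  then show ?case by (simp add: Suc mult_single)
qed

definition frob :: "nat \<Rightarrow> xzpoly \<Rightarrow> xzpoly" where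
  "frob p = pm_hom (scale_mono p) (poly_frob p)"

lemma pm_hom_scale:
  assumes "frobenius_lift p (h :: int poly \<Rightarrow> int poly)" "c > 0"
  shows "monomial_hom (scale_mono c :: ('v \<Rightarrow>\<^sub>0 nat) \<Rightarrow> _) (h ^^ n)"
proof -
  interpret frobenius_lift p h by fact
  show ?thesis
    by unfold_locales (auto simp: inj_scale_mono assms(2) scale_mono_add iterate_1 iterate_add iterate_mult)
qed

lemma frobenius_lift_frob:
  assumes p: "prime p"
  shows "frobenius_lift p (frob p)"
proof -
  interpret Z: frobenius_lift p "poly_frob p" by (rule frobenius_lift_poly_frob[OF p])
  interpret monomial_hom "scale_mono p :: (nat \<times> nat \<Rightarrow>\<^sub>0 nat) \<Rightarrow> _" "poly_frob p"
    using pm_hom_scale[OF Z.frobenius_lift_axioms prime_gt_0_nat[OF p], of 1] by simp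
  show ?thesis
  proof
    fix x y :: xzpoly
    show "prime p" by fact
    show "frob p 1 = 1" "frob p (x + y) = frob p x + frob p y" "frob p (x * y) = frob p x * frob p y"
      unfolding frob_def by (rule pm_hom_1 pm_hom_add pm_hom_mult)+
    show "of_nat p dvd x ^ p - frob p x"
    proof (induction x rule: poly_mapping_single_add_induct)
      case (1 m c)
      obtain d where d: "c ^ p - poly_frob p c = of_nat p * d" using Z.lift_cong[of c] by (auto simp: dvd_def)
      have "Poly_Mapping.single m c ^ p - frob p (Poly_Mapping.single m c)
          = Poly_Mapping.single (scale_mono p m) (of_nat p * d)"
        by (simp add: frob_def pm_hom_single power_single flip: d single_diff)
      also have "\<dots> = of_nat p * Poly_Mapping.single (scale_mono p m) d"
        using mult_single[of 0 "of_nat p" "scale_mono p m" d] by simp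
      finally show ?case by simp
    next
      case (2 f g)
      then show ?case
        unfolding frob_def pm_hom_add by (intro frobenius_cong_add[OF p])
    qed
  qed
qed

lemma frob_iterate:
  assumes p: "prime p"
  shows "(frob p ^^ n) x = pm_hom (scale_mono (p ^ n)) (poly_frob p ^^ n) x"
proof (induction n)
  case 0
  interpret monomial_hom "id :: (nat \<times> nat \<Rightarrow>\<^sub>0 nat) \<Rightarrow> _" "\<lambda>c::int poly. c" by unfold_locales auto
  have "pm_hom id (\<lambda>c. c) x = x" by (rule pm_hom_eqI) auto
  then show ?case by (simp add: id_def)
next
  case (Suc n)
  note fl = frobenius_lift_poly_frob[OF p] and p0 = prime_gt_0_nat[OF p]
  interpret A: monomial_hom "scale_mono p :: (nat \<times> nat \<Rightarrow>\<^sub>0 nat) \<Rightarrow> _" "poly_frob p"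
    using pm_hom_scale[OF fl p0, of 1] by simp
  interpret B: monomial_hom "scale_mono (p ^ n) :: (nat \<times> nat \<Rightarrow>\<^sub>0 nat) \<Rightarrow> _" "poly_frob p ^^ n"
    using p0 by (intro pm_hom_scale[OF fl]) simp
  interpret C: monomial_hom "scale_mono (p ^ Suc n) :: (nat \<times> nat \<Rightarrow>\<^sub>0 nat) \<Rightarrow> _" "poly_frob p ^^ Suc n"
    using p0 by (intro pm_hom_scale[OF fl]) simp
  have "pm_hom (scale_mono (p ^ Suc n)) (poly_frob p ^^ Suc n) x
      = pm_hom (scale_mono p) (poly_frob p) (pm_hom (scale_mono (p ^ n)) (poly_frob p ^^ n) x)"
  proof (rule C.pm_hom_eqI)
    fix m :: "nat \<times> nat \<Rightarrow>\<^sub>0 nat"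
    have "scale_mono (p ^ Suc n) m = scale_mono p (scale_mono (p ^ n) m)"
      by (simp add: scale_mono_scale_mono)
    then show "Poly_Mapping.lookup (pm_hom (scale_mono p) (poly_frob p) (pm_hom (scale_mono (p ^ n)) (poly_frob p ^^ n) x))
       (scale_mono (p ^ Suc n) m) = (poly_frob p ^^ Suc n) (Poly_Mapping.lookup x m)"
      by (simp add: A.lookup_pm_hom B.lookup_pm_hom)
  next
    fix m :: "nat \<times> nat \<Rightarrow>\<^sub>0 nat"
    assume m: "m \<notin> range (scale_mono (p ^ Suc n))"
    show "Poly_Mapping.lookup (pm_hom (scale_mono p) (poly_frob p) (pm_hom (scale_mono (p ^ n)) (poly_frob p ^^ n) x)) m = 0"
    proof (cases "m \<in> range (scale_mono p)")
      case True
      then obtain m' where m': "m = scale_mono p m'" by blast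
      then have "m' \<notin> range (scale_mono (p ^ n))" using m by (auto simp: scale_mono_scale_mono)
      then show ?thesis by (simp add: m' A.lookup_pm_hom B.lookup_pm_hom_notin A.h_0)
    qed (rule A.lookup_pm_hom_notin)
  qed
  then show ?case using Suc by (simp add: frob_def o_def)
qed

definition deg_le :: "'v \<Rightarrow> nat \<Rightarrow> (('v \<Rightarrow>\<^sub>0 nat) \<Rightarrow>\<^sub>0 'b::zero) \<Rightarrow> bool" where
  "deg_le x d f \<longleftrightarrow> (\<forall>m\<in>Poly_Mapping.keys f. Poly_Mapping.lookup m x \<le> d)"

lemma deg_le_mono: "deg_le x d f \<Longrightarrow> d \<le> e \<Longrightarrow> deg_le x e f"
  by (force simp: deg_le_def)

lemma deg_le_single: "Poly_Mapping.lookup m x \<le> d \<Longrightarrow> deg_le x d (Poly_Mapping.single m c)"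
  by (simp add: deg_le_def)

lemma deg_le_1: "deg_le x d (1 :: ('v \<Rightarrow>\<^sub>0 nat) \<Rightarrow>\<^sub>0 'b::zero_neq_one)"
  unfolding single_one[symmetric] by (rule deg_le_single) simp

lemma deg_le_diff:
  fixes f g :: "('v \<Rightarrow>\<^sub>0 nat) \<Rightarrow>\<^sub>0 'b::ab_group_add"
  shows "deg_le x d f \<Longrightarrow> deg_le x d g \<Longrightarrow> deg_le x d (f - g)"
  using keys_diff[of f g] by (fastforce simp: deg_le_def)

lemma deg_le_mult:
  fixes f g :: "('v \<Rightarrow>\<^sub>0 nat) \<Rightarrow>\<^sub>0 'b::semiring_0"
  shows "deg_le x d f \<Longrightarrow> deg_le x e g \<Longrightarrow> deg_le x (d + e) (f * g)"
  using keys_mult[of f g] by (fastforce simp: deg_le_def lookup_add intro: add_mono)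

lemma deg_le_power:
  fixes f :: "('v \<Rightarrow>\<^sub>0 nat) \<Rightarrow>\<^sub>0 'b::comm_semiring_1"
  shows "deg_le x d f \<Longrightarrow> deg_le x (n * d) (f ^ n)"
  by (induction n) (auto intro: deg_le_mult deg_le_1)

lemma deg_le_prod:
  fixes f :: "'i \<Rightarrow> ('v \<Rightarrow>\<^sub>0 nat) \<Rightarrow>\<^sub>0 'b::comm_semiring_1"
  shows "(\<And>i. i \<in> S \<Longrightarrow> deg_le x (d i) (f i)) \<Longrightarrow> deg_le x (sum d S) (prod f S)"
  by (induction S rule: infinite_finite_induct) (auto intro: deg_le_mult deg_le_1)

definition swap_var :: "nat \<Rightarrow> nat \<Rightarrow> nat \<Rightarrow> nat \<times> nat \<Rightarrow> nat \<times> nat" where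
  "swap_var i a b = Transposition.transpose (i, a) (i, b)"

lemma swap_var_Pair: "swap_var i a b (i', j) = (i', if i' = i then Transposition.transpose a b j else j)"
  by (auto simp: swap_var_def Transposition.transpose_def)

lemma swap_var_invol [simp]: "swap_var i a b (swap_var i a b x) = x"
  by (simp add: swap_var_def)

lemma inj_swap_var: "inj (swap_var i a b)"
  by (metis injI swap_var_invol)

definition swap_mono :: "nat \<Rightarrow> nat \<Rightarrow> nat \<Rightarrow> (nat \<times> nat \<Rightarrow>\<^sub>0 nat) \<Rightarrow> (nat \<times> nat \<Rightarrow>\<^sub>0 nat)" where
  "swap_mono i a b = Poly_Mapping.map_key (swap_var i a b)"

lemma lookup_swap_mono: "Poly_Mapping.lookup (swap_mono i a b m) x = Poly_Mapping.lookup m (swap_var i a b x)"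
  by (simp add: swap_mono_def map_key.rep_eq inj_swap_var)

lemma swap_mono_invol [simp]: "swap_mono i a b (swap_mono i a b m) = m"
  by (rule poly_mapping_eqI) (simp add: lookup_swap_mono)

lemma swap_mono_single:
  "swap_mono i a b (Poly_Mapping.single x d) = Poly_Mapping.single (swap_var i a b x) d"
proof (rule poly_mapping_eqI)
  fix y
  have "x = swap_var i a b y \<longleftrightarrow> swap_var i a b x = y" using swap_var_invol by metis
  then show "Poly_Mapping.lookup (swap_mono i a b (Poly_Mapping.single x d)) y
      = Poly_Mapping.lookup (Poly_Mapping.single (swap_var i a b x) d) y"
    by (simp add: lookup_swap_mono lookup_single)
qed

lemma swap_mono_scale: "swap_mono i a b (scale_mono c m) = scale_mono c (swap_mono i a b m)"
  by (rule poly_mapping_eqI) (auto simp: lookup_swap_mono scale_mono.rep_eq)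

definition swap_poly :: "nat \<Rightarrow> nat \<Rightarrow> nat \<Rightarrow> xzpoly \<Rightarrow> xzpoly" where
  "swap_poly i a b = pm_hom (swap_mono i a b) (\<lambda>c. c)"

interpretation swap: monomial_hom "swap_mono i a b" "\<lambda>c :: int poly. c"
proof
  show "inj (swap_mono i a b)" by (metis injI swap_mono_invol)
  show "swap_mono i a b 0 = 0" by (rule poly_mapping_eqI) (simp add: lookup_swap_mono)
  show "swap_mono i a b (m + m') = swap_mono i a b m + swap_mono i a b m'" for m m'
    by (rule poly_mapping_eqI) (simp add: lookup_swap_mono lookup_add)
qed auto

lemmas swap_poly_hom = swap.pm_hom_1[folded swap_poly_def] swap.pm_hom_add[folded swap_poly_def]
  swap.pm_hom_diff[folded swap_poly_def] swap.pm_hom_minus[folded swap_poly_def]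
  swap.pm_hom_mult[folded swap_poly_def]
  swap.pm_hom_power[folded swap_poly_def] swap.pm_hom_prod[folded swap_poly_def]

lemma swap_poly_xvar: "swap_poly i a b (xvar i' j) = xvar i' (if i' = i then Transposition.transpose a b j else j)"
  by (simp add: swap_poly_def xvar_def swap.pm_hom_single swap_mono_single swap_var_Pair)

lemma swap_poly_zvar: "swap_poly i a b zvar = zvar"
  by (simp add: swap_poly_def zvar_def swap.pm_hom_single swap.g_0)

lemma lookup_swap_poly:
  "Poly_Mapping.lookup (swap_poly i a b f) m = Poly_Mapping.lookup f (swap_mono i a b m)"
  using swap.lookup_pm_hom[of i a b f "swap_mono i a b m"] by (simp add: swap_poly_def)

text \<open>The variables \<open>x\<^sub>i\<^sub>,\<^sub>j\<close> with \<open>1 \<le> j \<le> v i\<close> form the \<open>i\<close>-th group.\<close>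

locale variable_groups =
  fixes v :: "nat \<Rightarrow> nat" and L :: nat
  assumes v_eq_0: "i = 0 \<or> i > L \<Longrightarrow> v i = 0"
begin

definition vars :: "(nat \<times> nat) set" where
  "vars = {(i, j). 1 \<le> j \<and> j \<le> v i}"

lemma vars_eq: "vars = (SIGMA i:{1..L}. {1..v i})"
proof (rule Set.set_eqI)
  fix x :: "nat \<times> nat"
  obtain i j where x: "x = (i, j)" by fastforce
  show "x \<in> vars \<longleftrightarrow> x \<in> (SIGMA i:{1..L}. {1..v i})"
    using v_eq_0[of i] by (cases "i = 0 \<or> i > L") (simp_all add: vars_def x)
qed

lemma finite_vars: "finite vars"
  by (simp add: vars_eq)

lemma sum_vars: "(\<Sum>x\<in>vars. f x) = (\<Sum>i=1..L. \<Sum>j=1..v i. f (i, j))"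
  by (simp add: vars_eq sum.Sigma)

lemma prod_vars: "(\<Prod>x\<in>vars. f x) = (\<Prod>i=1..L. \<Prod>j=1..v i. f (i, j))"
  by (simp add: vars_eq prod.Sigma)

lemma swap_var_vars:
  "1 \<le> a \<Longrightarrow> a \<le> v i \<Longrightarrow> 1 \<le> b \<Longrightarrow> b \<le> v i \<Longrightarrow> swap_var i a b x \<in> vars \<longleftrightarrow> x \<in> vars"
  by (cases x) (auto simp: vars_def swap_var_Pair Transposition.transpose_def split: if_splits)

definition staircase :: "nat \<times> nat \<Rightarrow>\<^sub>0 nat" where
  "staircase = (\<Sum>x\<in>vars. Poly_Mapping.single x (snd x))"

lemma lookup_staircase: "Poly_Mapping.lookup staircase x = (if x \<in> vars then snd x else 0)"
  using finite_vars by (auto simp: staircase_def lookup_sum lookup_single when_def sum.delta)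

definition in_box :: "(nat \<times> nat \<Rightarrow>\<^sub>0 nat) \<Rightarrow> bool" where
  "in_box u \<longleftrightarrow> (\<forall>i j. if (i, j) \<in> vars then 1 \<le> Poly_Mapping.lookup u (i, j) \<and> Poly_Mapping.lookup u (i, j) \<le> v i
                      else Poly_Mapping.lookup u (i, j) = 0)"

lemma alternating_transposition:
  fixes h :: "(nat \<times> nat \<Rightarrow>\<^sub>0 nat) \<Rightarrow> 'b::ab_group_add"
  assumes adj: "\<And>i j u. 1 \<le> j \<Longrightarrow> j + 1 \<le> v i \<Longrightarrow> h (swap_mono i j (j + 1) u) = - h u"
  shows "1 \<le> a \<Longrightarrow> a < b \<Longrightarrow> b \<le> v i \<Longrightarrow> h (swap_mono i a b u) = - h u"
proof (induction b arbitrary: u)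
  case (Suc b)
  show ?case
  proof (cases "a = b")
    case True
    then show ?thesis using adj[of b i u] Suc by simp
  next
    case False
    then have ab: "a < b" using Suc by simp
    have "swap_mono i a (Suc b) u = swap_mono i b (b + 1) (swap_mono i a b (swap_mono i b (b + 1) u))"
      using ab by (intro poly_mapping_eqI) (auto simp: lookup_swap_mono swap_var_def Transposition.transpose_def)
    also have "h \<dots> = - h (swap_mono i a b (swap_mono i b (b + 1) u))"
      using Suc ab by (intro adj) auto
    also have "\<dots> = h (swap_mono i b (b + 1) u)" using Suc ab by simp
    also have "\<dots> = - h u" using Suc ab by (intro adj) auto
    finally show ?thesis .
  qed
qed simp

lemma alternating_eq_0:
  fixes h :: "(nat \<times> nat \<Rightarrow>\<^sub>0 nat) \<Rightarrow> 'b::{idom, ring_char_0}"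
  assumes adj: "\<And>i j u. 1 \<le> j \<Longrightarrow> j + 1 \<le> v i \<Longrightarrow> h (swap_mono i j (j + 1) u) = - h u"
    and box: "\<And>u. h u \<noteq> 0 \<Longrightarrow> in_box u"
    and stair: "h staircase = 0"
  shows "h u = 0"
proof (induction "card {x\<in>vars. Poly_Mapping.lookup u x \<noteq> snd x}" arbitrary: u rule: less_induct)
  case less
  show ?case
  proof (rule ccontr)
    assume hu: "h u \<noteq> 0"
    then have bx: "in_box u" by (rule box)
    have swp: "h (swap_mono i a b w) = - h w"
      if "1 \<le> a" "1 \<le> b" "a \<le> v i" "b \<le> v i" "a \<noteq> b" for i a b w
    proof (cases "a < b")
      case True
      then show ?thesis using alternating_transposition[OF adj] that by blast
    next
      case False
      then have "h (swap_mono i b a w) = - h w" using alternating_transposition[OF adj, of b a i w] that by simp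
      moreover have "swap_mono i b a w = swap_mono i a b w"
        by (intro poly_mapping_eqI) (auto simp: lookup_swap_mono swap_var_def Transposition.transpose_def)
      ultimately show ?thesis by simp
    qed
    have inj: "Poly_Mapping.lookup u (i, a) \<noteq> Poly_Mapping.lookup u (i, b)"
      if ab: "1 \<le> a" "1 \<le> b" "a \<le> v i" "b \<le> v i" "a \<noteq> b" for i a b
    proof
      assume "Poly_Mapping.lookup u (i, a) = Poly_Mapping.lookup u (i, b)"
      then have "swap_mono i a b u = u"
        by (intro poly_mapping_eqI) (auto simp: lookup_swap_mono swap_var_def Transposition.transpose_def)
      then have "h u = - h u" using swp[OF ab, of u] by simp
      then have "2 * h u = 0" by (metis add.right_inverse mult_2)
      then show False using hu by simp
    qed
    have "u \<noteq> staircase" using hu stair by auto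
    then obtain x where "Poly_Mapping.lookup u x \<noteq> Poly_Mapping.lookup staircase x"
      by (auto simp: poly_mapping_eq_iff fun_eq_iff)
    then obtain i j where ij: "(i, j) \<in> vars" "Poly_Mapping.lookup u (i, j) \<noteq> j"
      using bx unfolding in_box_def by (cases x) (auto simp: lookup_staircase split: if_splits)
    then have j: "1 \<le> j" "j \<le> v i" by (auto simp: vars_def)
    have "(\<lambda>a. Poly_Mapping.lookup u (i, a)) ` {1..v i} = {1..v i}"
    proof (rule card_subset_eq)
      show "(\<lambda>a. Poly_Mapping.lookup u (i, a)) ` {1..v i} \<subseteq> {1..v i}"
      proof clarify
        fix a assume "a \<in> {1..v i}"
        then show "Poly_Mapping.lookup u (i, a) \<in> {1..v i}"
          using bx[unfolded in_box_def, rule_format, of i a] by (simp add: vars_def)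
      qed
      have "inj_on (\<lambda>a. Poly_Mapping.lookup u (i, a)) {1..v i}"
        using inj by (fastforce intro!: inj_onI)
      then show "card ((\<lambda>a. Poly_Mapping.lookup u (i, a)) ` {1..v i}) = card {1..v i}"
        by (rule card_image)
    qed simp
    then have "j \<in> (\<lambda>a. Poly_Mapping.lookup u (i, a)) ` {1..v i}" using j by simp
    then obtain b where b: "1 \<le> b" "b \<le> v i" "Poly_Mapping.lookup u (i, b) = j" by auto
    then have bj: "b \<noteq> j" using ij by auto
    let ?w = "swap_mono i j b u"
    have "{x\<in>vars. Poly_Mapping.lookup ?w x \<noteq> snd x} \<subset> {x\<in>vars. Poly_Mapping.lookup u x \<noteq> snd x}"
    proof (rule psubsetI)
      show "{x\<in>vars. Poly_Mapping.lookup ?w x \<noteq> snd x} \<subseteq> {x\<in>vars. Poly_Mapping.lookup u x \<noteq> snd x}"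
        using b bj j ij by (auto simp: lookup_swap_mono swap_var_def Transposition.transpose_def split: if_splits)
      have "(i, j) \<notin> {x\<in>vars. Poly_Mapping.lookup ?w x \<noteq> snd x}"
        using b by (simp add: lookup_swap_mono swap_var_def)
      moreover have "(i, j) \<in> {x\<in>vars. Poly_Mapping.lookup u x \<noteq> snd x}"
        using ij by simp
      ultimately show "{x\<in>vars. Poly_Mapping.lookup ?w x \<noteq> snd x} \<noteq> {x\<in>vars. Poly_Mapping.lookup u x \<noteq> snd x}"
        by metis
    qed
    then have "card {x\<in>vars. Poly_Mapping.lookup ?w x \<noteq> snd x} < card {x\<in>vars. Poly_Mapping.lookup u x \<noteq> snd x}"
      using finite_vars by (intro psubset_card_mono) auto
    then have "h ?w = 0" by (rule less)
    then show False using swp[of j b i u] j b bj hu by simp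
  qed
qed

definition vandermonde :: xzpoly where
  "vandermonde = (\<Prod>m=1..L. \<Prod>(i, j)\<in>{(i, j). 1 \<le> i \<and> i < j \<and> j \<le> v m}. (xvar m j - xvar m i))"

definition all_vars :: xzpoly where
  "all_vars = (\<Prod>x\<in>vars. xvar (fst x) (snd x))"

definition shifted_vandermonde :: xzpoly where
  "shifted_vandermonde = all_vars * vandermonde"

lemma finite_pairs: "finite {(i, j). 1 \<le> i \<and> i < j \<and> j \<le> (c::nat)}"
  by (rule finite_subset[of _ "{..c} \<times> {..c}"]) auto

lemma swap_all_vars:
  assumes "1 \<le> a" "a + 1 \<le> v i"
  shows "swap_poly i a (a + 1) all_vars = all_vars"
proof -
  have "swap_poly i a (a + 1) all_vars
      = (\<Prod>x\<in>vars. xvar (fst (swap_var i a (a + 1) x)) (snd (swap_var i a (a + 1) x)))"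
    unfolding all_vars_def swap_poly_hom
    by (rule prod.cong) (auto simp: swap_poly_xvar swap_var_Pair)
  also have "\<dots> = all_vars" unfolding all_vars_def
    by (rule prod.reindex_bij_witness[of _ "swap_var i a (a + 1)" "swap_var i a (a + 1)"])
       (use assms swap_var_vars[of a i "a + 1"] in auto)
  finally show ?thesis .
qed

lemma swap_vandermonde:
  assumes a: "1 \<le> a" "a + 1 \<le> v i"
  shows "swap_poly i a (a + 1) vandermonde = - vandermonde"
proof -
  define S where "S m = {(c, d). 1 \<le> c \<and> c < d \<and> d \<le> v m}" for m
  define f where "f m = (\<Prod>(c, d)\<in>S m. (xvar m d - xvar m c))" for m
  have i: "i \<in> {1..L}" using a v_eq_0[of i] by (cases "i = 0 \<or> i > L") auto
  have V: "vandermonde = f i * (\<Prod>m\<in>{1..L} - {i}. f m)"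
    using i by (simp add: vandermonde_def f_def S_def prod.remove)
  have other: "swap_poly i a (a + 1) (f m) = f m" if "m \<noteq> i" for m
    using that unfolding f_def swap_poly_hom by (intro prod.cong) (auto simp: swap_poly_hom swap_poly_xvar)
  let ?t = "Transposition.transpose a (a + 1)"
  define S' where "S' = S i - {(a, a + 1)}"
  have S: "(a, a + 1) \<in> S i" "finite (S i)" using a finite_pairs[of "v i"] by (auto simp: S_def)
  have f: "f i = (xvar i (a + 1) - xvar i a) * (\<Prod>(c, d)\<in>S'. (xvar i d - xvar i c))"
    unfolding f_def S'_def by (subst prod.remove[OF S(2,1)]) simp
  have "(\<Prod>(c, d)\<in>S'. (xvar i (?t d) - xvar i (?t c))) = (\<Prod>(c, d)\<in>S'. (xvar i d - xvar i c))"
    by (rule prod.reindex_bij_witness[of _ "map_prod ?t ?t" "map_prod ?t ?t"])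
       (use a in \<open>auto simp: S'_def S_def Transposition.transpose_def split: if_splits\<close>)
  then have "swap_poly i a (a + 1) (f i) = - f i"
    unfolding f swap_poly_hom
    by (simp add: swap_poly_xvar swap_poly_hom split_beta algebra_simps)
  moreover have "swap_poly i a (a + 1) (\<Prod>m\<in>{1..L} - {i}. f m) = (\<Prod>m\<in>{1..L} - {i}. f m)"
    unfolding swap_poly_hom by (intro prod.cong other) auto
  ultimately show ?thesis unfolding V swap_poly_hom by simp
qed

lemma deg_le_xvar: "deg_le x (if x = (i, j) then 1 else 0) (xvar i j)"
  unfolding xvar_def by (rule deg_le_single) (simp add: lookup_single)

lemma deg_le_xvar_diff: "deg_le x (if x = (i, j) \<or> x = (i', j') then 1 else 0) (xvar i j - xvar i' j')"
  by (intro deg_le_diff deg_le_mono[OF deg_le_xvar]) auto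

lemma deg_le_vandermonde: "deg_le x (if x \<in> vars then v (fst x) - 1 else 0) vandermonde"
proof -
  obtain i j where x: "x = (i, j)" by fastforce
  define S where "S m = {(c, d). 1 \<le> c \<and> c < d \<and> d \<le> v m}" for m
  have fin: "finite (S m)" for m using finite_pairs[of "v m"] by (simp add: S_def)
  define T where "T = {y\<in>S i. fst y = j \<or> snd y = j}"
  have "deg_le x (\<Sum>m=1..L. \<Sum>y\<in>S m. if x = (m, snd y) \<or> x = (m, fst y) then 1 else 0) vandermonde"
    unfolding vandermonde_def S_def[symmetric] split_beta
    by (intro deg_le_prod deg_le_xvar_diff)
  also have "(\<Sum>m=1..L. \<Sum>y\<in>S m. if x = (m, snd y) \<or> x = (m, fst y) then 1 else 0)
      = (\<Sum>m=1..L. if m = i then card T else 0)"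
  proof (intro sum.cong refl)
    fix m
    have "(\<Sum>y\<in>S m. if x = (m, snd y) \<or> x = (m, fst y) then 1 else 0)
       = card {y\<in>S m. x = (m, snd y) \<or> x = (m, fst y)}"
      using fin by (simp flip: sum.inter_filter)
    also have "{y\<in>S m. x = (m, snd y) \<or> x = (m, fst y)} = (if m = i then T else {})"
      by (auto simp: x T_def)
    finally show "(\<Sum>y\<in>S m. if x = (m, snd y) \<or> x = (m, fst y) then 1 else 0) = (if m = i then card T else 0)"
      by simp
  qed
  finally have 1: "deg_le x (\<Sum>m=1..L. if m = i then card T else 0) vandermonde" .
  have "card T \<le> (if x \<in> vars then v i - 1 else 0)"
  proof (cases "x \<in> vars")
    case True
    define g where "g y = (if fst y = j then snd y else fst y)" for y :: "nat \<times> nat"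
    have "card T \<le> card ({1..v i} - {j})"
    proof (rule card_inj_on_le[of g])
      show "inj_on g T" by (rule inj_onI) (auto simp: g_def T_def S_def split: if_splits)
      show "g ` T \<subseteq> {1..v i} - {j}" by (auto simp: g_def T_def S_def)
    qed simp
    then show ?thesis using True by (simp add: x vars_def)
  next
    case False
    then have "T = {}" by (auto simp: x T_def S_def vars_def)
    then show ?thesis by simp
  qed
  then have "(\<Sum>m=1..L. if m = i then card T else 0) \<le> (if x \<in> vars then v (fst x) - 1 else 0)"
    by (auto simp: sum.delta x)
  then show ?thesis by (rule deg_le_mono[OF 1])
qed

lemma all_vars_eq: "all_vars = Poly_Mapping.single (\<Sum>x\<in>vars. Poly_Mapping.single x 1) 1"
proof -
  have "(\<Prod>x\<in>S. xvar (fst x) (snd x)) = Poly_Mapping.single (\<Sum>x\<in>S. Poly_Mapping.single x 1) 1" for S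
    by (induction S rule: infinite_finite_induct) (auto simp: xvar_def mult_single)
  then show ?thesis by (simp add: all_vars_def)
qed

lemma lookup_sum_vars: "Poly_Mapping.lookup (\<Sum>x\<in>vars. Poly_Mapping.single x (d x)) y = (if y \<in> vars then d y else 0)"
  using finite_vars by (auto simp: lookup_sum lookup_single when_def sum.delta)

end

lemma lookup_single_mult:
  fixes f :: "('a::cancel_comm_monoid_add) \<Rightarrow>\<^sub>0 ('b::comm_semiring_1)"
  shows "Poly_Mapping.lookup (Poly_Mapping.single m c * f) (m + n) = c * Poly_Mapping.lookup f n"
  by (induction f rule: poly_mapping_single_add_induct)
     (auto simp: mult_single lookup_single when_def distrib_left lookup_add)

definition monic_at :: "('a \<Rightarrow> nat) \<Rightarrow> ('a \<Rightarrow>\<^sub>0 'b::comm_ring_1) \<Rightarrow> 'a \<Rightarrow> bool" where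
  "monic_at wt f \<mu> \<longleftrightarrow> (\<exists>g. f = Poly_Mapping.single \<mu> 1 + g \<and> (\<forall>m\<in>Poly_Mapping.keys g. wt m < wt \<mu>))"

lemma lookup_monic_at: "monic_at wt f \<mu> \<Longrightarrow> Poly_Mapping.lookup f \<mu> = 1"
  by (auto simp: monic_at_def lookup_add in_keys_iff)

lemma monic_at_mult:
  fixes f g :: "'a::comm_monoid_add \<Rightarrow>\<^sub>0 'b::comm_ring_1"
  assumes wt: "\<And>m n. wt (m + n) = wt m + wt n" and "monic_at wt f \<mu>" "monic_at wt g \<nu>"
  shows "monic_at wt (f * g) (\<mu> + \<nu>)"
proof -
  obtain f' where f: "f = Poly_Mapping.single \<mu> 1 + f'" "\<And>m. m \<in> Poly_Mapping.keys f' \<Longrightarrow> wt m < wt \<mu>"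
    using assms by (auto simp: monic_at_def)
  obtain g' where g: "g = Poly_Mapping.single \<nu> 1 + g'" "\<And>m. m \<in> Poly_Mapping.keys g' \<Longrightarrow> wt m < wt \<nu>"
    using assms by (auto simp: monic_at_def)
  let ?r = "(Poly_Mapping.single \<mu> 1 + f') * g' + f' * Poly_Mapping.single \<nu> 1"
  have "f * g = Poly_Mapping.single (\<mu> + \<nu>) 1 + ?r"
    by (simp add: f(1) g(1) algebra_simps mult_single)
  moreover have "wt m < wt (\<mu> + \<nu>)" if "m \<in> Poly_Mapping.keys ?r" for m
  proof -
    from that have "m \<in> Poly_Mapping.keys ((Poly_Mapping.single \<mu> 1 + f') * g')
        \<or> m \<in> Poly_Mapping.keys (f' * Poly_Mapping.single \<nu> 1)"
      using keys_add[of "(Poly_Mapping.single \<mu> 1 + f') * g'" "f' * Poly_Mapping.single \<nu> 1"] by blast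
    then show ?thesis
    proof
      assume "m \<in> Poly_Mapping.keys ((Poly_Mapping.single \<mu> 1 + f') * g')"
      then obtain a b where "m = a + b" "a \<in> Poly_Mapping.keys (Poly_Mapping.single \<mu> (1::'b) + f')" "b \<in> Poly_Mapping.keys g'"
        using keys_mult[of "Poly_Mapping.single \<mu> 1 + f'" g'] by blast
      moreover from this have "wt a \<le> wt \<mu>"
        using keys_add[of "Poly_Mapping.single \<mu> (1::'b)" f'] f(2) by (fastforce intro: less_imp_le)
      ultimately show ?thesis using g(2)[of b] by (simp add: wt)
    next
      assume "m \<in> Poly_Mapping.keys (f' * Poly_Mapping.single \<nu> 1)"
      then obtain a where "m = a + \<nu>" "a \<in> Poly_Mapping.keys f'"
        using keys_mult[of f' "Poly_Mapping.single \<nu> 1"] by (auto split: if_splits)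
      then show ?thesis using f(2)[of a] by (simp add: wt)
    qed
  qed
  ultimately show ?thesis unfolding monic_at_def by blast
qed

lemma monic_at_prod:
  assumes wt: "\<And>m n. wt (m + n) = wt m + wt n" and "\<And>i. i \<in> S \<Longrightarrow> monic_at wt (f i) (\<mu> i)"
  shows "monic_at wt (\<Prod>i\<in>S. f i) (\<Sum>i\<in>S. \<mu> i)"
  using assms(2)
proof (induction S rule: infinite_finite_induct)
  case (insert i S)
  have "monic_at wt (f i * prod f S) (\<mu> i + sum \<mu> S)"
    by (rule monic_at_mult[OF wt]) (use insert in auto)
  then show ?case using insert by simp
qed (auto simp: monic_at_def intro!: exI[of _ 0])

context variable_groups
begin

lemma lookup_vandermonde:
  "Poly_Mapping.lookup vandermonde (\<Sum>x\<in>vars. Poly_Mapping.single x (snd x - 1)) = 1"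
proof -
  define S where "S m = {(c, d). 1 \<le> c \<and> c < d \<and> d \<le> v m}" for m
  define wt where "wt m = (\<Sum>x\<in>vars. snd x * Poly_Mapping.lookup m x)" for m :: "nat \<times> nat \<Rightarrow>\<^sub>0 nat"
  have wt: "wt (m + n) = wt m + wt n" for m n
    by (simp add: wt_def lookup_add distrib_left sum.distrib)
  have wt_single: "wt (Poly_Mapping.single x 1) = (if x \<in> vars then snd x else 0)" for x
    using finite_vars by (auto simp: wt_def lookup_single when_def sum.delta if_distrib cong: if_cong)
  have factor: "monic_at wt (xvar m (snd y) - xvar m (fst y)) (Poly_Mapping.single (m, snd y) 1)"
    if "y \<in> S m" for m y
  proof -
    have "xvar m (snd y) - xvar m (fst y) = Poly_Mapping.single (Poly_Mapping.single (m, snd y) 1) 1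
        + Poly_Mapping.single (Poly_Mapping.single (m, fst y) 1) (- 1)"
      by (simp add: xvar_def single_uminus)
    moreover have "wt (Poly_Mapping.single (m, fst y) 1) < wt (Poly_Mapping.single (m, snd y) 1)"
      unfolding wt_single using that by (auto simp: S_def vars_def)
    ultimately show ?thesis unfolding monic_at_def by auto
  qed
  have "monic_at wt vandermonde (\<Sum>m=1..L. \<Sum>y\<in>S m. Poly_Mapping.single (m, snd y) 1)"
    unfolding vandermonde_def S_def[symmetric] split_beta
    by (intro monic_at_prod wt factor)
  moreover have "(\<Sum>y\<in>S m. Poly_Mapping.single (m, snd y) 1) = (\<Sum>d=1..v m. Poly_Mapping.single (m, d) (d - 1))" for m
  proof -
    have "(\<Sum>y\<in>S m. Poly_Mapping.single (m, snd y) (1::nat))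
        = (\<Sum>y\<in>(SIGMA d:{1..v m}. {1..<d}). Poly_Mapping.single (m, fst y) 1)"
      by (rule sum.reindex_bij_witness[of _ prod.swap prod.swap]) (auto simp: S_def)
    also have "\<dots> = (\<Sum>d=1..v m. \<Sum>c\<in>{1..<d}. Poly_Mapping.single (m, d) 1)"
      by (subst sum.Sigma) (simp_all add: split_beta del: sum_constant)
    also have "\<dots> = (\<Sum>d=1..v m. Poly_Mapping.single (m, d) (d - 1))"
    proof (rule sum.cong[OF refl])
      fix d
      show "(\<Sum>c\<in>{1..<d}. Poly_Mapping.single (m, d) (1::nat)) = Poly_Mapping.single (m, d) (d - 1)"
        by (rule poly_mapping_eqI) (unfold lookup_sum lookup_single when_def, simp)
    qed
    finally show ?thesis .
  qed
  ultimately show ?thesis using lookup_monic_at by (simp add: sum_vars)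
qed

lemma lookup_shifted_vandermonde: "Poly_Mapping.lookup shifted_vandermonde staircase = 1"
proof -
  have "staircase = (\<Sum>x\<in>vars. Poly_Mapping.single x 1) + (\<Sum>x\<in>vars. Poly_Mapping.single x (snd x - 1))"
  proof (rule poly_mapping_eqI)
    fix y
    have "snd y \<ge> 1" if "y \<in> vars" using that by (auto simp: vars_def)
    then show "Poly_Mapping.lookup staircase y = Poly_Mapping.lookup
        ((\<Sum>x\<in>vars. Poly_Mapping.single x 1) + (\<Sum>x\<in>vars. Poly_Mapping.single x (snd x - 1))) y"
      unfolding lookup_add lookup_sum_vars lookup_staircase by (cases "y \<in> vars") simp_all
  qed
  then show ?thesis
    by (simp only: shifted_vandermonde_def all_vars_eq lookup_single_mult lookup_vandermonde mult_1)
qed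

lemma swap_shifted_vandermonde:
  "1 \<le> a \<Longrightarrow> a + 1 \<le> v i \<Longrightarrow> swap_poly i a (a + 1) shifted_vandermonde = - shifted_vandermonde"
  by (simp add: shifted_vandermonde_def swap_poly_hom swap_all_vars[simplified] swap_vandermonde[simplified])

lemma in_box_of_nonzero:
  assumes Q: "Q \<ge> 1" and deg: "\<And>x. deg_le x (if x \<in> vars then (Q - 1) * (v (fst x) + 1) else 0) A"
    and nz: "Poly_Mapping.lookup (shifted_vandermonde * A) (scale_mono Q u) \<noteq> 0"
  shows "in_box u"
proof -
  let ?e = "\<Sum>x\<in>vars. Poly_Mapping.single x (1::nat)"
  have "scale_mono Q u \<in> Poly_Mapping.keys (Poly_Mapping.single ?e 1 * (vandermonde * A))"
    using nz by (simp add: in_keys_iff shifted_vandermonde_def all_vars_eq mult.assoc)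
  then obtain m where m: "scale_mono Q u = ?e + m" "m \<in> Poly_Mapping.keys (vandermonde * A)"
    using keys_mult[of "Poly_Mapping.single ?e 1" "vandermonde * A"] by auto
  have bound: "Poly_Mapping.lookup m x \<le> (if x \<in> vars then v (fst x) - 1 else 0)
      + (if x \<in> vars then (Q - 1) * (v (fst x) + 1) else 0)" for x
    using deg_le_mult[OF deg_le_vandermonde deg, of x] m(2) unfolding deg_le_def by blast
  have eq: "Q * Poly_Mapping.lookup u x = (if x \<in> vars then 1 else 0) + Poly_Mapping.lookup m x" for x
    using arg_cong[OF m(1), of "\<lambda>w. Poly_Mapping.lookup w x"]
    unfolding lookup_add lookup_sum_vars by (simp add: scale_mono.rep_eq)
  show ?thesis unfolding in_box_def
  proof (intro allI)
    fix i j
    let ?u = "Poly_Mapping.lookup u (i, j)"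
    show "if (i, j) \<in> vars then 1 \<le> ?u \<and> ?u \<le> v i else ?u = 0"
    proof (cases "(i, j) \<in> vars")
      case True
      then have "v i \<ge> 1" by (auto simp: vars_def)
      have "Q * ?u \<le> v i + (Q - 1) * (v i + 1)"
        using eq[of "(i, j)"] bound[of "(i, j)"] True \<open>v i \<ge> 1\<close> by simp
      also have "\<dots> < (Q - 1) * (v i + 1) + (v i + 1)" by simp
      also have "\<dots> = Q * (v i + 1)" using Q by (cases Q) auto
      finally have "Q * ?u < Q * (v i + 1)" .
      then have "?u < v i + 1" by (simp only: mult_less_cancel1)
      moreover have "?u \<noteq> 0"
      proof
        assume "?u = 0"
        then show False using eq[of "(i, j)"] True by simp
      qed
      ultimately show ?thesis using True by simp
    next
      case False
      then show ?thesis using eq[of "(i, j)"] bound[of "(i, j)"] Q by simp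
    qed
  qed
qed

lemma lookup_divisible:
  assumes Q: "Q \<ge> 1" and deg: "\<And>x. deg_le x (if x \<in> vars then (Q - 1) * (v (fst x) + 1) else 0) A"
    and sym: "\<And>i a. 1 \<le> a \<Longrightarrow> a + 1 \<le> v i \<Longrightarrow> swap_poly i a (a + 1) A = A"
  shows "Poly_Mapping.lookup (shifted_vandermonde * A) (scale_mono Q u)
    = Poly_Mapping.lookup (shifted_vandermonde * A) (scale_mono Q staircase)
      * Poly_Mapping.lookup shifted_vandermonde u"
proof -
  let ?B = "shifted_vandermonde * A"
  let ?c = "Poly_Mapping.lookup ?B (scale_mono Q staircase)"
  define h where "h u = Poly_Mapping.lookup ?B (scale_mono Q u) - ?c * Poly_Mapping.lookup shifted_vandermonde u" for u
  have "h u = 0"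
  proof (rule alternating_eq_0)
    fix i j u assume ij: "1 \<le> j" "j + 1 \<le> v i"
    have "swap_poly i j (j + 1) ?B = - ?B"
      using swap_shifted_vandermonde[OF ij] sym[OF ij] by (simp add: swap_poly_hom)
    then have 1: "Poly_Mapping.lookup ?B (swap_mono i j (j + 1) w) = - Poly_Mapping.lookup ?B w" for w
      by (metis lookup_swap_poly lookup_uminus)
    have 2: "Poly_Mapping.lookup shifted_vandermonde (swap_mono i j (j + 1) w)
        = - Poly_Mapping.lookup shifted_vandermonde w" for w
      using swap_shifted_vandermonde[OF ij] by (metis lookup_swap_poly lookup_uminus)
    show "h (swap_mono i j (j + 1) u) = - h u"
      unfolding h_def 2 swap_mono_scale[symmetric] 1 by simp
  next
    fix u assume "h u \<noteq> 0"
    then have "\<not> (Poly_Mapping.lookup ?B (scale_mono Q u) = 0 \<and> Poly_Mapping.lookup shifted_vandermonde u = 0)"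
      by (auto simp: h_def)
    then consider "Poly_Mapping.lookup ?B (scale_mono Q u) \<noteq> 0" | "Poly_Mapping.lookup shifted_vandermonde u \<noteq> 0"
      by blast
    then show "in_box u"
    proof cases
      case 1
      then show ?thesis by (rule in_box_of_nonzero[OF Q deg])
    next
      case 2
      then show ?thesis by (intro in_box_of_nonzero[of 1 1]) (auto simp: deg_le_1)
    qed
  qed (simp add: h_def lookup_shifted_vandermonde)
  then show ?thesis by (simp add: h_def)
qed

definition stair_coeff :: "nat \<Rightarrow> nat \<Rightarrow> xzpoly \<Rightarrow> int poly" where
  "stair_coeff p s C = Poly_Mapping.lookup (shifted_vandermonde * C) (scale_mono (p ^ s) staircase)"

lemma stair_coeff_0_1: "stair_coeff p 0 1 = 1"
  by (simp add: stair_coeff_def lookup_shifted_vandermonde)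

lemma stair_coeff_sum: "stair_coeff p s (sum f S) = (\<Sum>i\<in>S. stair_coeff p s (f i))"
  by (simp add: stair_coeff_def sum_distrib_left lookup_sum)

lemma stair_coeff_dvd:
  assumes "of_nat c dvd C"
  shows "of_nat c dvd stair_coeff p s C"
proof -
  obtain k where "C = of_nat c * k" using assms by (auto simp: dvd_def)
  then have "stair_coeff p s C = of_nat c * stair_coeff p s k"
    using lookup_single_mult[of 0 "of_nat c :: int poly" "shifted_vandermonde * k"]
    by (simp add: stair_coeff_def mult.left_commute[of _ "of_nat c"])
  then show ?thesis by (rule dvdI)
qed

lemma monomial_hom_coeff:
  assumes "prime p"
  shows "monomial_hom (\<lambda>m :: nat \<times> nat \<Rightarrow>\<^sub>0 nat. m) (poly_frob p ^^ a)"
proof -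
  interpret frobenius_lift p "poly_frob p" by (rule frobenius_lift_poly_frob[OF assms])
  show ?thesis by unfold_locales (auto simp: iterate_1 iterate_add iterate_mult)
qed

lemma poly_frob_lookup_shifted_vandermonde:
  assumes "prime p"
  shows "(poly_frob p ^^ a) (Poly_Mapping.lookup shifted_vandermonde u) = Poly_Mapping.lookup shifted_vandermonde u"
proof -
  interpret monomial_hom "\<lambda>m :: nat \<times> nat \<Rightarrow>\<^sub>0 nat. m" "poly_frob p ^^ a"
    by (rule monomial_hom_coeff[OF assms])
  have "pm_hom (\<lambda>m. m) (poly_frob p ^^ a) (xvar i j) = xvar i j" for i j
    by (simp add: xvar_def pm_hom_single h_1)
  then have "pm_hom (\<lambda>m. m) (poly_frob p ^^ a) shifted_vandermonde = shifted_vandermonde"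
    by (simp add: shifted_vandermonde_def all_vars_def vandermonde_def pm_hom_mult pm_hom_prod pm_hom_diff
        split_beta)
  then show ?thesis using lookup_pm_hom[of shifted_vandermonde u] by simp
qed

lemma stair_coeff_mult:
  assumes p: "prime p"
    and deg: "\<And>x. deg_le x (if x \<in> vars then (p ^ a - 1) * (v (fst x) + 1) else 0) A"
    and sym: "\<And>i a. 1 \<le> a \<Longrightarrow> a + 1 \<le> v i \<Longrightarrow> swap_poly i a (a + 1) A = A"
  shows "stair_coeff p (a + b) (A * (frob p ^^ a) C) = stair_coeff p a A * (poly_frob p ^^ a) (stair_coeff p b C)"
proof -
  let ?Q = "p ^ a" and ?c = "stair_coeff p a A"
  have Q: "?Q \<ge> 1" using prime_gt_0_nat[OF p] by simp
  interpret monomial_hom "scale_mono ?Q :: (nat \<times> nat \<Rightarrow>\<^sub>0 nat) \<Rightarrow> _" "poly_frob p ^^ a"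
    using prime_gt_0_nat[OF p] by (intro pm_hom_scale[OF frobenius_lift_poly_frob[OF p]]) simp
  have frob: "(frob p ^^ a) x = pm_hom (scale_mono ?Q) (poly_frob p ^^ a) x" for x
    by (rule frob_iterate[OF p])
  have inj: "scale_mono ?Q m = scale_mono ?Q m' \<longleftrightarrow> m = m'" for m m' :: "nat \<times> nat \<Rightarrow>\<^sub>0 nat"
    using g_inj by (simp add: inj_eq)
  define R where "R = shifted_vandermonde * A - Poly_Mapping.single 0 ?c * (frob p ^^ a) shifted_vandermonde"
  have R0: "Poly_Mapping.lookup R (scale_mono ?Q u) = 0" for u
    using lookup_single_mult[of 0 ?c "(frob p ^^ a) shifted_vandermonde" "scale_mono ?Q u"]
      lookup_divisible[OF Q deg sym, of u] unfolding frob
    by (simp add: R_def lookup_minus lookup_pm_hom poly_frob_lookup_shifted_vandermonde[OF p] stair_coeff_def frob)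
  have R_frob: "Poly_Mapping.lookup (R * (frob p ^^ a) C) (scale_mono ?Q w) = 0" for w
  proof (rule ccontr)
    assume "Poly_Mapping.lookup (R * (frob p ^^ a) C) (scale_mono ?Q w) \<noteq> 0"
    then have "scale_mono ?Q w \<in> Poly_Mapping.keys (R * (frob p ^^ a) C)" by (simp add: in_keys_iff)
    then obtain m m' where m: "scale_mono ?Q w = m + m'" "m \<in> Poly_Mapping.keys R"
        "m' \<in> Poly_Mapping.keys ((frob p ^^ a) C)"
      using keys_mult[of R "(frob p ^^ a) C"] by blast
    obtain u where u: "m' = scale_mono ?Q u" using m(3) keys_pm_hom[of C] unfolding frob by blast
    have "m = scale_mono ?Q w - m'" by (simp add: m(1))
    also have "\<dots> = scale_mono ?Q (w - u)"
      by (rule poly_mapping_eqI) (simp add: u lookup_minus scale_mono.rep_eq diff_mult_distrib2)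
    finally show False using R0[of "w - u"] m(2) by (simp add: in_keys_iff)
  qed
  have "shifted_vandermonde * (A * (frob p ^^ a) C) = R * (frob p ^^ a) C
      + Poly_Mapping.single 0 ?c * (frob p ^^ a) (shifted_vandermonde * C)"
    unfolding frob pm_hom_mult by (simp add: R_def frob algebra_simps)
  then have "stair_coeff p (a + b) (A * (frob p ^^ a) C) = Poly_Mapping.lookup
      (Poly_Mapping.single 0 ?c * (frob p ^^ a) (shifted_vandermonde * C)) (0 + scale_mono ?Q (scale_mono (p ^ b) staircase))"
    by (simp add: stair_coeff_def lookup_add R_frob scale_mono_scale_mono power_add flip: scale_mono_scale_mono)
  also have "\<dots> = ?c * (poly_frob p ^^ a) (stair_coeff p b C)"
    unfolding lookup_single_mult frob lookup_pm_hom by (simp add: stair_coeff_def)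
  finally show ?thesis .
qed

end

subsection \<open>The master polynomial\<close>

lemma geometric_sum_nat: "p \<ge> 1 \<Longrightarrow> (p - 1) * (\<Sum>m<a. p ^ m) = p ^ a - (1::nat)"
proof (induction a)
  case (Suc a)
  have "(p - 1) * (\<Sum>m<Suc a. p ^ m) = (p ^ a - 1) + (p - 1) * p ^ a"
    using Suc by (simp add: distrib_left)
  also have "\<dots> = p ^ Suc a - 1"
    using Suc.prems by (cases p) (auto simp: Suc_leI)
  finally show ?case .
qed simp

context variable_groups
begin

lemma dwork_stair_coeff:
  assumes p: "prime p"
    and deg: "\<And>x. deg_le x (if x \<in> vars then (p - 1) * (v (fst x) + 1) else 0) F"
    and sym: "\<And>i a. 1 \<le> a \<Longrightarrow> a + 1 \<le> v i \<Longrightarrow> swap_poly i a (a + 1) F = F"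
    and T: "\<And>s. T s = stair_coeff p s (\<Prod>m<s. F ^ p ^ m)"
    and ab: "a \<le> b"
  shows "of_nat p ^ Suc a dvd T (Suc b) * poly_frob p (T a) - T (Suc a) * poly_frob p (T b)"
proof -
  interpret X: frobenius_lift p "frob p" by (rule frobenius_lift_frob[OF p])
  interpret Z: frobenius_lift p "poly_frob p" by (rule frobenius_lift_poly_frob[OF p])
  have p1: "p \<ge> 1" using prime_gt_0_nat[OF p] by simp
  have T': "T s = stair_coeff p s (X.partial_prod F s)" for s
    by (simp add: T X.partial_prod_def)
  have deg': "deg_le x (if x \<in> vars then (p ^ s - 1) * (v (fst x) + 1) else 0) (X.partial_prod F s)" for x s
  proof -
    have "deg_le x (\<Sum>m<s. p ^ m * (if x \<in> vars then (p - 1) * (v (fst x) + 1) else 0)) (X.partial_prod F s)"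
      unfolding X.partial_prod_def by (intro deg_le_prod deg_le_power deg)
    also have "(\<Sum>m<s. p ^ m * (if x \<in> vars then (p - 1) * (v (fst x) + 1) else 0))
        = (if x \<in> vars then ((p - 1) * (\<Sum>m<s. p ^ m)) * (v (fst x) + 1) else 0)"
      by (simp add: sum_distrib_left sum_distrib_right mult_ac)
    finally show ?thesis by (simp only: geometric_sum_nat[OF p1])
  qed
  have sym': "swap_poly i a (a + 1) (X.partial_prod F s) = X.partial_prod F s"
    if "1 \<le> a" "a + 1 \<le> v i" for i a s
    unfolding X.partial_prod_def swap_poly_hom using sym[OF that] by simp
  define G where "G n = stair_coeff p (Suc n) (X.dwork_coeff F 1 n)" for n
  show ?thesis
  proof (rule Z.dwork_congruence[OF _ _ ab])
    fix s
    have "T (Suc s) = stair_coeff p (Suc s)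
        (\<Sum>n\<le>s. X.partial_prod F (s - n) * (frob p ^^ (s - n)) (X.dwork_coeff F 1 n))"
      using X.partial_prod_expansion[of F s 1] by (simp add: T')
    also have "\<dots> = (\<Sum>n\<le>s. T (s - n) * (poly_frob p ^^ (s - n)) (G n))"
      unfolding stair_coeff_sum
    proof (rule sum.cong[OF refl])
      fix n assume "n \<in> {..s}"
      then have "Suc s = (s - n) + Suc n" by simp
      then show "stair_coeff p (Suc s) (X.partial_prod F (s - n) * (frob p ^^ (s - n)) (X.dwork_coeff F 1 n))
          = T (s - n) * (poly_frob p ^^ (s - n)) (G n)"
        using stair_coeff_mult[OF p deg' sym', of "s - n" "Suc n" "X.dwork_coeff F 1 n"]
        by (simp add: T' G_def)
    qed
    finally show "T (Suc s) = (\<Sum>n\<le>s. T (s - n) * (poly_frob p ^^ (s - n)) (G n))" .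
  next
    fix n
    show "of_nat p ^ n dvd G n"
      using stair_coeff_dvd[of "p ^ n" "X.dwork_coeff F 1 n" p "Suc n"] X.dwork_coeff_dvd[of n F 1]
      by (simp add: G_def)
  qed
qed

lemma prod_group_swap:
  assumes "1 \<le> c" "c + 1 \<le> v i"
  shows "(\<Prod>a=1..v m. f (if m = i then Transposition.transpose c (c + 1) a else a)) = (\<Prod>a=1..v m. f a)"
proof (cases "m = i")
  case True
  then show ?thesis using assms
    by (intro prod.reindex_bij_witness[of _ "Transposition.transpose c (c + 1)" "Transposition.transpose c (c + 1)"])
       (auto simp: Transposition.transpose_def)
qed simp

definition link_prod :: xzpoly where
  "link_prod = (\<Prod>i=1..L - 1. \<Prod>a=1..v i. \<Prod>b=1..v (i + 1). (xvar i a - xvar (i + 1) b))"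

lemma swap_link_prod:
  assumes c: "1 \<le> c" "c + 1 \<le> v i"
  shows "swap_poly i c (c + 1) link_prod = link_prod"
proof -
  define t where "t m a = (if m = i then Transposition.transpose c (c + 1) a else a)" for m a
  have "swap_poly i c (c + 1) link_prod
      = (\<Prod>m=1..L - 1. \<Prod>a=1..v m. \<Prod>b=1..v (m + 1). (xvar m (t m a) - xvar (m + 1) (t (m + 1) b)))"
    unfolding link_prod_def swap_poly_hom swap_poly_xvar t_def ..
  also have "\<dots> = (\<Prod>m=1..L - 1. \<Prod>a=1..v m. \<Prod>b=1..v (m + 1). (xvar m (t m a) - xvar (m + 1) b))"
  proof (rule prod.cong[OF refl], rule prod.cong[OF refl])
    fix m a
    show "(\<Prod>b=1..v (m + 1). (xvar m (t m a) - xvar (m + 1) (t (m + 1) b)))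
        = (\<Prod>b=1..v (m + 1). (xvar m (t m a) - xvar (m + 1) b))"
      using prod_group_swap[OF c, of "\<lambda>b. xvar m (t m a) - xvar (m + 1) b" "m + 1"] unfolding t_def .
  qed
  also have "\<dots> = link_prod"
    unfolding t_def link_prod_def
    using prod_group_swap[OF c, of "\<lambda>a. \<Prod>b=1..v (m + 1). (xvar m a - xvar (m + 1) b)" m for m] by simp
  finally show ?thesis .
qed

lemma deg_le_link_prod: "deg_le x (if x \<in> vars then v (fst x + 1) + v (fst x - 1) else 0) link_prod"
proof -
  obtain i j where x: "x = (i, j)" by fastforce
  have "deg_le x (\<Sum>m=1..L - 1. \<Sum>a=1..v m. \<Sum>b=1..v (m + 1).
      (if x = (m, a) then 1 else 0) + (if x = (m + 1, b) then 1 else 0)) link_prod"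
    unfolding link_prod_def by (intro deg_le_prod deg_le_mono[OF deg_le_xvar_diff]) auto
  also have "(\<Sum>m=1..L - 1. \<Sum>a=1..v m. \<Sum>b=1..v (m + 1).
      (if x = (m, a) then 1 else 0) + (if x = (m + 1, b) then 1 else (0::nat)))
     = (\<Sum>m=1..L - 1. (if m = i then (if x \<in> vars then v (i + 1) else 0) else 0)
          + (if m = i - 1 then (if x \<in> vars then v (i - 1) else 0) else 0))"
  proof (rule sum.cong[OF refl])
    fix m assume m: "m \<in> {1..L - 1}"
    have "(\<Sum>a=1..v m. \<Sum>b=1..v (m + 1). (if x = (m, a) then 1 else (0::nat)))
        = (\<Sum>a=1..v m. if a = j then (if i = m then v (m + 1) else 0) else 0)"
      by (intro sum.cong) (auto simp: x)
    also have "\<dots> = (if m = i then (if x \<in> vars then v (i + 1) else 0) else 0)"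
      by (auto simp: sum.delta x vars_def)
    finally have 1: "(\<Sum>a=1..v m. \<Sum>b=1..v (m + 1). (if x = (m, a) then 1 else (0::nat)))
        = (if m = i then (if x \<in> vars then v (i + 1) else 0) else 0)" .
    have "(\<Sum>b=1..v (m + 1). (if x = (m + 1, b) then 1 else (0::nat)))
        = (\<Sum>b=1..v (m + 1). if b = j then (if i = m + 1 then 1 else 0) else 0)"
      by (intro sum.cong) (auto simp: x)
    also have "\<dots> = (if m = i - 1 \<and> x \<in> vars then 1 else 0)"
      using m by (auto simp: sum.delta x vars_def)
    finally have 2: "(\<Sum>a=1..v m. \<Sum>b=1..v (m + 1). (if x = (m + 1, b) then 1 else (0::nat)))
        = (if m = i - 1 then (if x \<in> vars then v (i - 1) else 0) else 0)" by simp
    show "(\<Sum>a=1..v m. \<Sum>b=1..v (m + 1).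
      (if x = (m, a) then 1 else 0) + (if x = (m + 1, b) then 1 else (0::nat)))
      = (if m = i then (if x \<in> vars then v (i + 1) else 0) else 0)
          + (if m = i - 1 then (if x \<in> vars then v (i - 1) else 0) else 0)"
      unfolding sum.distrib 1 2 ..
  qed
  finally have 3: "deg_le x (\<Sum>m=1..L - 1. (if m = i then (if x \<in> vars then v (i + 1) else 0) else 0)
          + (if m = i - 1 then (if x \<in> vars then v (i - 1) else 0) else 0)) link_prod" .
  show ?thesis
    by (rule deg_le_mono[OF 3]) (auto simp: sum.distrib sum.delta x)
qed

definition end_prod :: "nat \<Rightarrow> nat \<Rightarrow> xzpoly" where
  "end_prod k k' = (\<Prod>a=1..v k. zvar - xvar k a) * (\<Prod>a=1..v k'. 1 - xvar k' a)"

lemma swap_end_prod: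
  assumes c: "1 \<le> c" "c + 1 \<le> v i"
  shows "swap_poly i c (c + 1) (end_prod k k') = end_prod k k'"
  unfolding end_prod_def swap_poly_hom swap_poly_xvar swap_poly_zvar
    prod_group_swap[OF c, of "\<lambda>a. zvar - xvar k a" k] prod_group_swap[OF c, of "\<lambda>a. 1 - xvar k' a" k'] ..

lemma deg_le_end_prod:
  "deg_le x (if x \<in> vars then of_bool (fst x = k) + of_bool (fst x = k') else 0) (end_prod k k')"
proof -
  obtain i j where x: "x = (i, j)" by fastforce
  have z: "deg_le x d (zvar - xvar m a)" and o: "deg_le x d (1 - xvar m a)" if "d = (if x = (m, a) then 1 else 0)" for d m a
    unfolding that by (intro deg_le_diff deg_le_xvar deg_le_1; simp add: zvar_def deg_le_single)+
  have 1: "deg_le x ((\<Sum>a=1..v k. if x = (k, a) then 1 else 0) + (\<Sum>a=1..v k'. if x = (k', a) then 1 else 0)) (end_prod k k')"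
    unfolding end_prod_def by (intro deg_le_mult deg_le_prod z o refl)
  have 2: "(\<Sum>a=1..v m. if x = (m, a) then 1 else (0::nat)) = (if x \<in> vars then of_bool (fst x = m) else 0)" for m
  proof -
    have "(\<Sum>a=1..v m. if x = (m, a) then 1 else (0::nat)) = (\<Sum>a=1..v m. if a = j then of_bool (i = m) else 0)"
      by (intro sum.cong) (auto simp: x)
    then show ?thesis by (auto simp: sum.delta x vars_def)
  qed
  show ?thesis using 1 unfolding 2 by (cases "x \<in> vars") (simp_all only: if_True if_False add_0)
qed

lemma deg_le_all_vars: "deg_le x (if x \<in> vars then 1 else 0) all_vars"
  unfolding all_vars_eq by (rule deg_le_single) (simp only: lookup_sum_vars)

end

lemma variable_groups_vdim:
  assumes "k \<ge> 1" "n \<ge> 2 * k"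
  shows "variable_groups (vdim n k) (n - 1)"
  by standard (use assms in \<open>auto simp: vdim_def\<close>)

lemma vdim_neighbours:
  assumes "k \<ge> 1" "n \<ge> 2 * k" "1 \<le> i" "i \<le> n - 1"
  shows "vdim n k (i + 1) + vdim n k (i - 1) + (of_bool (i = k) + of_bool (i = n - k)) = 2 * vdim n k i"
  using assms by (auto simp: vdim_def)

lemma lookup_minus_one_power_mult:
  "Poly_Mapping.lookup ((- 1) ^ c * f :: 'a::comm_monoid_add \<Rightarrow>\<^sub>0 'b::comm_ring_1) m = (- 1) ^ c * Poly_Mapping.lookup f m"
  by (cases "even c") auto

locale master_setup =
  fixes n k r q l p :: nat
  assumes k: "k \<ge> 1" and n: "n \<ge> 2 * k" and q: "q > 0" and rq: "2 * r \<le> q"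
    and p: "prime p" and odd_p: "odd p" and p_eq: "p = l * q + 1"
begin

sublocale variable_groups "vdim n k" "n - 1"
  by (rule variable_groups_vdim[OF k n])

lemma vdim_k: "vdim n k k = k" "vdim n k (n - k) = k"
  using k n by (auto simp: vdim_def)

lemma Delta_eq: "Delta n k = vandermonde"
  unfolding Delta_def vandermonde_def ..

lemma p_power_minus_1: "p ^ s - 1 = q * (l * (\<Sum>m<s. p ^ m))"
  using geometric_sum_nat[of p s] by (simp add: p_eq mult_ac)

lemma Phi_bar_eq:
  "Phi_bar n k r q p s = (all_vars ^ (l * (q - r)) * vandermonde ^ (l * (q - 2 * r))
      * link_prod ^ (l * r) * end_prod k (n - k) ^ (l * r)) ^ (\<Sum>m<s. p ^ m)"
proof -
  have e: "(p ^ s - 1) * c div q = l * c * (\<Sum>m<s. p ^ m)" for c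
    unfolding p_power_minus_1 using q by (simp add: mult.assoc mult.left_commute)
  have 1: "(\<Prod>i=1..n-1. \<Prod>j=1..vdim n k i. xvar i j) = all_vars"
    using prod_vars[of "\<lambda>x. xvar (fst x) (snd x)"] by (simp add: all_vars_def)
  have 2: "(\<Prod>i=1..n-2. \<Prod>a=1..vdim n k i. \<Prod>b=1..vdim n k (i + 1). (xvar i a - xvar (i + 1) b)) = link_prod"
  proof -
    have "n - 1 - 1 = n - 2" by simp
    then show ?thesis unfolding link_prod_def by (simp only:)
  qed
  have 3: "(\<Prod>i=1..k. (zvar - xvar k i) * (1 - xvar (n - k) i)) = end_prod k (n - k)"
    by (simp add: end_prod_def vdim_k prod.distrib)
  show ?thesis
    unfolding Phi_bar_def 1 2 3 Delta_eq e by (simp add: power_mult_distrib power_mult)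
qed

definition master :: xzpoly where
  "master = (- 1) ^ (l * r * N_exp n k) * (all_vars ^ (l * (q - r)) * vandermonde ^ (l * (q - 2 * r))
      * link_prod ^ (l * r) * end_prod k (n - k) ^ (l * r))"

lemma swap_master:
  assumes "1 \<le> a" "a + 1 \<le> vdim n k i"
  shows "swap_poly i a (a + 1) master = master"
proof -
  have "even (l * q)" using odd_p by (simp add: p_eq)
  moreover have "l * q = l * (q - 2 * r) + 2 * (l * r)"
    using rq by (simp add: diff_mult_distrib2 mult.left_commute)
  ultimately have "even (l * (q - 2 * r))" by (metis dvd_add_left_iff dvd_triv_left)
  then have "(- vandermonde) ^ (l * (q - 2 * r)) = vandermonde ^ (l * (q - 2 * r))" by simp
  then show ?thesis
    unfolding master_def swap_poly_hom swap_all_vars[OF assms] swap_vandermonde[OF assms]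
      swap_link_prod[OF assms] swap_end_prod[OF assms] by simp
qed

lemma deg_le_master: "deg_le x (if x \<in> vars then (p - 1) * (vdim n k (fst x) + 1) else 0) master"
proof -
  obtain i j where x: "x = (i, j)" by fastforce
  let ?v = "vdim n k"
  have sgn: "deg_le x 0 ((- 1) ^ c :: xzpoly)" for c
  proof -
    have "deg_le x 0 (- 1 :: xzpoly)"
      using deg_le_1[of x 0, where 'b = "int poly"] by (simp add: deg_le_def)
    then show ?thesis by (cases "even c") (simp_all add: deg_le_1)
  qed
  have "deg_le x (0 + (l * (q - r) * (if x \<in> vars then 1 else 0)
      + l * (q - 2 * r) * (if x \<in> vars then ?v (fst x) - 1 else 0)
      + l * r * (if x \<in> vars then ?v (fst x + 1) + ?v (fst x - 1) else 0)
      + l * r * (if x \<in> vars then of_bool (fst x = k) + of_bool (fst x = n - k) else 0))) master"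
    unfolding master_def
    by (intro deg_le_mult deg_le_power sgn deg_le_all_vars deg_le_vandermonde deg_le_link_prod deg_le_end_prod)
  then show ?thesis
  proof (rule deg_le_mono, cases "x \<in> vars")
    case True
    then have i: "1 \<le> i" "i \<le> n - 1" and v1: "?v i \<ge> 1"
      using v_eq_0[of i] unfolding x vars_def by (cases "i = 0 \<or> i > n - 1"; auto)+
    obtain w where w: "?v i = Suc w" using v1 by (cases "?v i") auto
    obtain d where d: "q = 2 * r + d" using rq le_Suc_ex by blast
    have "l * r * (?v (i + 1) + ?v (i - 1)) + l * r * (of_bool (i = k) + of_bool (i = n - k)) = l * r * (2 * ?v i)"
      unfolding vdim_neighbours[OF k n i, symmetric] by (simp add: algebra_simps)
    then show "0 + (l * (q - r) * (if x \<in> vars then 1 else 0)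
      + l * (q - 2 * r) * (if x \<in> vars then ?v (fst x) - 1 else 0)
      + l * r * (if x \<in> vars then ?v (fst x + 1) + ?v (fst x - 1) else 0)
      + l * r * (if x \<in> vars then of_bool (fst x = k) + of_bool (fst x = n - k) else 0))
      \<le> (if x \<in> vars then (p - 1) * (?v (fst x) + 1) else 0)"
      using True by (simp add: x p_eq w d algebra_simps)
  qed simp
qed

lemma T_poly_eq: "T_poly n k r q p s = stair_coeff p s (\<Prod>m<s. master ^ p ^ m)"
proof (cases "s = 0")
  case True
  then show ?thesis using stair_coeff_0_1[of p] by (simp add: T_poly_def)
next
  case False
  let ?g = "\<Sum>m<s. p ^ m"
  let ?m = "\<Sum>i=1..n-1. \<Sum>j=1..vdim n k i. Poly_Mapping.single (i, j) (j * p ^ s - 1)"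
  have e: "(p ^ s - 1) * r div q * N_exp n k = l * r * N_exp n k * ?g"
    unfolding p_power_minus_1 using q by (simp add: mult_ac)
  have m: "?m = (\<Sum>x\<in>vars. Poly_Mapping.single x (snd x * p ^ s - 1))"
    by (simp add: sum_vars)
  have "scale_mono (p ^ s) staircase = (\<Sum>x\<in>vars. Poly_Mapping.single x 1) + ?m"
  proof (rule poly_mapping_eqI)
    fix y
    show "Poly_Mapping.lookup (scale_mono (p ^ s) staircase) y
        = Poly_Mapping.lookup ((\<Sum>x\<in>vars. Poly_Mapping.single x 1) + ?m) y"
    proof (cases "y \<in> vars")
      case True
      then have "1 \<le> snd y * p ^ s" using prime_gt_0_nat[OF p] by (auto simp: vars_def Suc_le_eq)
      then have "snd y * p ^ s = 1 + (snd y * p ^ s - 1)" by (rule le_add_diff_inverse[symmetric])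
      then show ?thesis
        unfolding m lookup_add lookup_sum_vars scale_mono.rep_eq lookup_staircase if_P[OF True]
          mult.commute[of "p ^ s"] .
    next
      case False
      then show ?thesis
        unfolding m lookup_add lookup_sum_vars scale_mono.rep_eq lookup_staircase by simp
    qed
  qed
  then have "stair_coeff p s C = Poly_Mapping.lookup (vandermonde * C) ?m" for C
    unfolding stair_coeff_def shifted_vandermonde_def all_vars_eq mult.assoc
    by (simp only: lookup_single_mult mult_1)
  moreover have "(\<Prod>m<s. master ^ p ^ m) = (- 1) ^ (l * r * N_exp n k * ?g) * Phi_bar n k r q p s"
  proof -
    have "(\<Prod>m<s. master ^ p ^ m) = master ^ ?g" by (rule power_sum[symmetric])
    then show ?thesis unfolding Phi_bar_eq master_def by (simp only: power_mult_distrib power_mult)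
  qed
  ultimately show ?thesis using False
    by (simp only: T_poly_def Phi_def Delta_eq e if_False lookup_minus_one_power_mult
        mult.left_commute[of vandermonde "(- 1) ^ c" for c])
qed

lemma T_poly_dwork:
  "a \<le> b \<Longrightarrow> of_nat p ^ Suc a dvd T_poly n k r q p (Suc b) * poly_frob p (T_poly n k r q p a)
      - T_poly n k r q p (Suc a) * poly_frob p (T_poly n k r q p b)"
  by (rule dwork_stair_coeff[OF p deg_le_master swap_master T_poly_eq])

end

section \<open>Limits of quotients of integer polynomials\<close>

subsection \<open>The p-adic norm\<close>

lemma padic_norm_eq_dist: "padic_norm x = dist x 0"
  by (simp add: dist_padic_def)

lemma padic_norm_0 [simp]: "padic_norm 0 = 0"
  by (simp add: padic_norm_eq_dist)

lemma padic_norm_nonneg [simp]: "padic_norm x \<ge> 0"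
  by (simp add: padic_norm_eq_dist)

lemma padic_norm_eq_0_iff [simp]: "padic_norm x = 0 \<longleftrightarrow> x = 0"
  by (simp add: padic_norm_eq_dist)

lemma padic_norm_1 [simp]: "padic_norm 1 = 1"
  using padic_norm_of_int[of 1] by simp

lemma padic_norm_minus [simp]: "padic_norm (- x) = padic_norm x"
  by transfer (rule norm_seq_minus)

lemma padic_norm_minus_commute: "padic_norm (x - y) = padic_norm (y - x)"
  by (metis minus_diff_eq padic_norm_minus)

lemma padic_norm_power: "padic_norm (x ^ n) = padic_norm x ^ n"
  by (induction n) (auto simp: padic_norm_mult)

lemma padic_norm_divide: "padic_norm (x / y) = padic_norm x / padic_norm y"
proof (cases "y = 0")
  case False
  then have "padic_norm (x / y) * padic_norm y = padic_norm x"
    by (simp flip: padic_norm_mult)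
  then show ?thesis using False by (simp add: field_simps)
qed simp

lemma padic_norm_add_le_max: "padic_norm (x + y) \<le> max (padic_norm x) (padic_norm y)"
proof transfer
  fix X Y :: "'a pcauchy_seq"
  show "norm_seq (X + Y) \<le> max (norm_seq X) (norm_seq Y)"
    by (rule LIMSEQ_le[OF norm_seq_tendsto tendsto_max[OF norm_seq_tendsto norm_seq_tendsto]])
       (use rat_pabs_add_le_max[OF prime_card] in \<open>auto simp: plus_pcauchy_seq.rep_eq\<close>)
qed

lemma padic_norm_add_le: "padic_norm x \<le> e \<Longrightarrow> padic_norm y \<le> e \<Longrightarrow> padic_norm (x + y) \<le> e"
  using padic_norm_add_le_max[of x y] by linarith

lemma padic_norm_add_less: "padic_norm x < e \<Longrightarrow> padic_norm y < e \<Longrightarrow> padic_norm (x + y) < e"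
  using padic_norm_add_le_max[of x y] by linarith

lemma padic_norm_diff_le: "padic_norm x \<le> e \<Longrightarrow> padic_norm y \<le> e \<Longrightarrow> padic_norm (x - y) \<le> e"
  using padic_norm_add_le[of x e "- y"] by simp

lemma padic_norm_diff_trans_le:
  "padic_norm (x - y) \<le> e \<Longrightarrow> padic_norm (y - z) \<le> e \<Longrightarrow> padic_norm (x - z) \<le> e"
  using padic_norm_add_le[of "x - y" e "y - z"] by simp

lemma padic_norm_diff_trans_less:
  "padic_norm (x - y) < e \<Longrightarrow> padic_norm (y - z) < e \<Longrightarrow> padic_norm (x - z) < e"
  using padic_norm_add_less[of "x - y" e "y - z"] by simp

lemma padic_norm_eq_1_cong:
  assumes "padic_norm x = 1" "padic_norm (y - x) < 1"
  shows "padic_norm y = 1"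
proof -
  have "padic_norm y \<le> 1" using padic_norm_add_le[of "y - x" 1 x] assms by simp
  moreover have "\<not> padic_norm y < 1"
    using padic_norm_add_less[of y 1 "x - y"] assms padic_norm_minus_commute[of x y] by auto
  ultimately show ?thesis by simp
qed

lemma padic_norm_sum_le:
  assumes "e \<ge> 0" "\<And>i. i \<in> S \<Longrightarrow> padic_norm (f i) \<le> e"
  shows "padic_norm (sum f S) \<le> e"
  using assms by (induction S rule: infinite_finite_induct) (auto intro: padic_norm_add_le)

lemma padic_norm_p: "padic_norm (of_nat CARD('p) :: 'p::prime_card padic) = 1 / real CARD('p)"
proof -
  have "prime CARD('p)" by (rule prime_card)
  then have p: "prime (int CARD('p))" "CARD('p) > 0" using prime_gt_0_nat by auto
  have "padic_norm (of_int (int CARD('p)) :: 'p padic) = 1 / real CARD('p)"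
    unfolding padic_norm_of_int using p
    by (auto simp: rat_pabs_def rat_pval_def power_int_minus inverse_eq_divide)
  then show ?thesis by simp
qed

lemma card_prime_gt_1: "real CARD('p::prime_card) > 1"
  using prime_gt_1_nat[OF prime_card[where 'a = 'p]] by simp

lemma padic_norm_of_int_le_1: "padic_norm (of_int a) \<le> 1"
proof -
  have n: "padic_norm (of_nat m) \<le> 1" for m
    by (induction m) (auto intro!: padic_norm_add_le)
  show ?thesis by (cases a rule: int_cases2) (auto simp: n)
qed

lemma padic_norm_of_int_dvd:
  assumes "int CARD('p) ^ m dvd a"
  shows "padic_norm (of_int a :: 'p::prime_card padic) \<le> (1 / real CARD('p)) ^ m"
proof -
  obtain c where a: "a = int CARD('p) ^ m * c" using assms by (auto simp: dvd_def)
  have "padic_norm (of_int a :: 'p padic) = (1 / real CARD('p)) ^ m * padic_norm (of_int c :: 'p padic)"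
    by (simp add: a padic_norm_mult padic_norm_power padic_norm_p)
  also have "\<dots> \<le> (1 / real CARD('p)) ^ m"
    using padic_norm_of_int_le_1[of c] by (intro mult_left_le) auto
  finally show ?thesis .
qed

lemma padic_int_power [intro]: "x \<in> padic_int \<Longrightarrow> x ^ n \<in> padic_int"
  by (auto simp: padic_int_def padic_norm_power power_le_one)

lemma padic_int_of_int [intro]: "of_int a \<in> padic_int"
  by (simp add: padic_int_def padic_norm_of_int_le_1)

lemma padic_norm_power_diff_le:
  assumes "x \<in> padic_int" "y \<in> padic_int"
  shows "padic_norm (x ^ n - y ^ n) \<le> padic_norm (x - y)"
proof -
  have "padic_norm (\<Sum>i<n. y ^ (n - Suc i) * x ^ i) \<le> 1"
    using assms by (intro padic_norm_sum_le) (auto simp: padic_int_def padic_norm_mult padic_norm_power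
        intro!: mult_le_one power_le_one)
  then show ?thesis
    by (simp add: power_diff_sumr2 padic_norm_mult mult_left_le)
qed

lift_definition const_seq :: "rat \<Rightarrow> 'p::prime_card pcauchy_seq" is "\<lambda>q n. q" by simp

definition padic_of_rat :: "rat \<Rightarrow> 'p::prime_card padic" where
  "padic_of_rat q = abs_padic (const_seq q)"

lemma padic_of_rat_diff: "padic_of_rat (x - y) = padic_of_rat x - padic_of_rat y"
  unfolding padic_of_rat_def minus_padic.abs_eq
  by (rule arg_cong[of _ _ abs_padic], transfer) simp

lemma padic_of_rat_of_int: "padic_of_rat (of_int a) = (of_int a :: 'p::prime_card padic)"
proof -
  have "const_seq (of_int a) = (of_int a :: 'p pcauchy_seq)"
    by (simp add: const_seq.rep_eq Rep_pcauchy_seq_of_int flip: Rep_pcauchy_seq_inject)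
  then show ?thesis by (simp add: padic_of_rat_def of_int_padic)
qed

lemma padic_norm_of_rat: "padic_norm (padic_of_rat q :: 'p::prime_card padic) = rat_pabs CARD('p) q"
  by (simp add: padic_of_rat_def padic_norm.abs_eq norm_seq.rep_eq const_seq.rep_eq)

lemma norm_diff_of_rat_tendsto:
  fixes X :: "'p::prime_card pcauchy_seq"
  shows "(\<lambda>m. rat_pabs CARD('p) (Rep_pcauchy_seq X m - q)) \<longlonglongrightarrow> padic_norm (abs_padic X - padic_of_rat q)"
  using norm_seq_tendsto[of "X - const_seq q"]
  by (simp add: padic_of_rat_def minus_padic.abs_eq padic_norm.abs_eq minus_pcauchy_seq.rep_eq
      const_seq.rep_eq)

lemma padic_of_rat_dense:
  fixes x :: "'p::prime_card padic"
  assumes "e > 0"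
  obtains q where "padic_norm (x - padic_of_rat q) \<le> e"
proof -
  obtain X where X: "x = abs_padic X" using padic.abs_induct[of "\<lambda>x. \<exists>X. x = abs_padic X" x] by blast
  have "pcauchy CARD('p) (Rep_pcauchy_seq X)" using Rep_pcauchy_seq by blast
  then obtain M where M: "\<forall>m\<ge>M. \<forall>n\<ge>M. rat_pabs CARD('p) (Rep_pcauchy_seq X m - Rep_pcauchy_seq X n) < e"
    using assms unfolding pcauchy_def by blast
  have "padic_norm (x - padic_of_rat (Rep_pcauchy_seq X M)) \<le> e"
    unfolding X by (rule LIMSEQ_le_const2[OF norm_diff_of_rat_tendsto]) (use M less_imp_le in blast)
  then show ?thesis by (rule that)
qed

lemma padic_limit_exists:
  fixes x :: "nat \<Rightarrow> 'p::prime_card padic"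
  assumes x: "\<And>s. padic_norm (x (Suc s) - x s) \<le> (1 / real CARD('p)) ^ Suc s"
  shows "\<exists>y. \<forall>s. padic_norm (y - x s) \<le> (1 / real CARD('p)) ^ Suc s"
proof -
  let ?e = "\<lambda>s. (1 / real CARD('p)) ^ Suc s"
  have P: "real CARD('p) > 1" by (rule card_prime_gt_1)
  have mono: "?e t \<le> ?e s" if "s \<le> t" for s t
    using P that by (intro power_decreasing) auto
  have "\<exists>q. padic_norm (x s - padic_of_rat q) \<le> ?e s" for s
  proof -
    have "?e s > 0" using P by (intro zero_less_power) simp
    then show ?thesis by (metis padic_of_rat_dense)
  qed
  then obtain q where q: "\<And>s. padic_norm (x s - padic_of_rat (q s)) \<le> ?e s" by metis
  have step: "rat_pabs CARD('p) (q (Suc s) - q s) \<le> ?e s" for s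
  proof -
    have 1: "padic_norm (padic_of_rat (q (Suc s)) - x (Suc s)) \<le> ?e s"
      using q[of "Suc s"] mono[of s "Suc s"] by (simp add: padic_norm_minus_commute)
    have "padic_norm (padic_of_rat (q (Suc s)) - padic_of_rat (q s) :: 'p padic) \<le> ?e s"
      by (rule padic_norm_diff_trans_le[OF padic_norm_diff_trans_le[OF 1 x] q])
    then show ?thesis by (simp add: padic_norm_of_rat flip: padic_of_rat_diff)
  qed
  have dist: "rat_pabs CARD('p) (q (s + d) - q s) \<le> ?e s" for s d
  proof (induction d)
    case 0
    then show ?case by simp
  next
    case (Suc d)
    have "rat_pabs CARD('p) (q (Suc (s + d)) - q (s + d)) \<le> ?e s"
      using step[of "s + d"] mono[of s "s + d"] by simp
    then show ?case
      using rat_pabs_add_le_max[OF prime_card[where 'a = 'p],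
          of "q (Suc (s + d)) - q (s + d)" "q (s + d) - q s"] Suc
      by simp
  qed
  have "pcauchy CARD('p) q"
    unfolding pcauchy_def
  proof (intro allI impI)
    fix e :: real assume "e > 0"
    have "?e \<longlonglongrightarrow> 0"
      using P by (intro LIMSEQ_power_zero[THEN LIMSEQ_Suc]) auto
    then obtain M where M: "?e M < e"
      using order_tendstoD(2)[OF _ \<open>e > 0\<close>] eventually_sequentially by (metis (no_types, lifting) order_refl)
    have "rat_pabs CARD('p) (q m - q n) < e" if "m \<ge> M" "n \<ge> M" for m n
      using rat_pabs_add_le_max[OF prime_card[where 'a = 'p], of "q m - q M" "q M - q n"] that M
        dist[of M "m - M"] dist[of M "n - M"] rat_pabs_minus_commute[of "CARD('p)" "q M" "q n"]
      by auto
    then show "\<exists>M. \<forall>m\<ge>M. \<forall>n\<ge>M. rat_pabs CARD('p) (q m - q n) < e" by blast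
  qed
  then have rep: "Rep_pcauchy_seq (Abs_pcauchy_seq q :: 'p pcauchy_seq) = q"
    by (simp add: Abs_pcauchy_seq_inverse)
  have "padic_norm (abs_padic (Abs_pcauchy_seq q) - x s) \<le> ?e s" for s
  proof (rule padic_norm_diff_trans_le)
    show "padic_norm (abs_padic (Abs_pcauchy_seq q) - padic_of_rat (q s) :: 'p padic) \<le> ?e s"
      by (rule LIMSEQ_le_const2[OF norm_diff_of_rat_tendsto])
         (use dist[of s] in \<open>auto simp: rep le_iff_add\<close>)
    show "padic_norm (padic_of_rat (q s) - x s) \<le> ?e s"
      using q[of s] by (simp add: padic_norm_minus_commute)
  qed
  then show ?thesis by blast
qed

lemma padic_int_residue:
  fixes x :: "'p::prime_card padic"
  assumes "x \<in> padic_int"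
  obtains c :: int where "padic_norm (x - of_int c) < 1"
proof -
  have prime: "prime CARD('p)" by (rule prime_card)
  obtain q where q: "padic_norm (x - padic_of_rat q) \<le> 1 / 2" by (rule padic_of_rat_dense[of "1/2"]) auto
  have "padic_norm (padic_of_rat q - x + x) \<le> 1"
    using q assms by (intro padic_norm_add_le) (auto simp: padic_int_def padic_norm_minus_commute)
  then have q1: "rat_pabs CARD('p) q \<le> 1" by (simp add: padic_norm_of_rat)
  obtain a b where ab: "q = Rat.Fract a b" "b > 0" "coprime a b" by (cases q) auto
  have ndvd: "\<not> int CARD('p) dvd b"
  proof
    assume dvd: "int CARD('p) dvd b"
    then have na: "\<not> int CARD('p) dvd a" using ab(3) prime
      by (metis coprime_common_divisor not_prime_unit prime_nat_int_transfer)
    then have a0: "a \<noteq> 0" by auto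
    have "multiplicity (int CARD('p)) b > 0" using dvd ab(2) prime
      by (subst prime_multiplicity_gt_zero_iff) auto
    moreover have "multiplicity (int CARD('p)) a = 0" using na by (rule not_dvd_imp_multiplicity_0)
    ultimately have "rat_pval CARD('p) q < 0"
      using rat_pval_Fract[OF prime a0, of b] ab(2) by (simp add: ab(1))
    moreover have "q \<noteq> 0" using a0 ab(2) by (simp add: ab(1) Zero_rat_def eq_rat)
    ultimately have "rat_pabs CARD('p) q > 1"
      using card_prime_gt_1[where 'p = 'p] one_less_power_int[of "real CARD('p)" "- rat_pval CARD('p) q"]
      by (simp add: rat_pabs_def)
    then show False using q1 by simp
  qed
  then have cop: "coprime b (int CARD('p))" using prime
    by (metis coprime_commute prime_imp_coprime prime_nat_int_transfer)
  then obtain c where c: "[b * c = 1] (mod int CARD('p))" by (metis coprime_iff_invertible_int)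
  then have "int CARD('p) dvd a * (b * c - 1)" by (simp add: cong_iff_dvd_diff)
  then have d: "int CARD('p) ^ 1 dvd a * c * b - a" by (simp add: algebra_simps)
  have b1: "padic_norm (of_int b :: 'p padic) = 1"
    using ndvd ab(2) by (auto simp: padic_norm_of_int rat_pabs_def rat_pval_def not_dvd_imp_multiplicity_0)
  have "(of_int (a * c) - q) * of_int b = of_int (a * c * b - a)"
    using ab by (simp add: Fract_of_int_quotient algebra_simps)
  then have "padic_norm (padic_of_rat (of_int (a * c) - q) :: 'p padic) * padic_norm (of_int b :: 'p padic)
     = padic_norm (of_int (a * c * b - a) :: 'p padic)"
    by (metis padic_norm_of_rat padic_norm_of_int rat_pabs_mult[OF prime])
  also have "\<dots> \<le> 1 / real CARD('p)" using padic_norm_of_int_dvd[OF d] by simp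
  also have "\<dots> < 1" using card_prime_gt_1[where 'p = 'p] by simp
  finally have "padic_norm (padic_of_rat q - of_int (a * c) :: 'p padic) < 1"
    by (simp add: b1 padic_of_rat_diff padic_of_rat_of_int padic_norm_minus_commute del: of_int_mult)
  then have "padic_norm (x - of_int (a * c)) < 1"
    using q padic_norm_diff_trans_less[of x "padic_of_rat q" 1] by simp
  then show ?thesis by (rule that)
qed

subsection \<open>Residue discs\<close>

lemma teichmueller_unique:
  fixes s t :: "'p::prime_card padic"
  assumes "s \<in> padic_int" "t \<in> padic_int" "padic_norm (s - t) < 1"
    and s: "s ^ CARD('p) = s" and t: "t ^ CARD('p) = t"
  shows "s = t"
proof (rule ccontr)
  assume "s \<noteq> t"
  let ?P = "CARD('p)" and ?S = "\<Sum>i<CARD('p). t ^ (CARD('p) - Suc i) * s ^ i"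
  have "?S - of_nat ?P * t ^ (?P - 1) = (\<Sum>i<?P. t ^ (?P - Suc i) * (s ^ i - t ^ i))"
    by (simp add: sum_subtractf right_diff_distrib flip: power_add)
  also have "padic_norm \<dots> \<le> padic_norm (s - t)"
  proof (intro padic_norm_sum_le)
    fix i
    show "padic_norm (t ^ (?P - Suc i) * (s ^ i - t ^ i)) \<le> padic_norm (s - t)"
      using padic_norm_power_diff_le[OF assms(1,2), of i] padic_int_power[OF assms(2), of "?P - Suc i"]
      by (auto simp: padic_norm_mult padic_int_def intro: order_trans[OF mult_left_le_one_le])
  qed simp
  finally have 1: "padic_norm (?S - of_nat ?P * t ^ (?P - 1)) < 1" using assms(3) by simp
  have "padic_norm (of_nat ?P * t ^ (?P - 1)) \<le> padic_norm (of_nat ?P :: 'p padic)"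
    using padic_int_power[OF assms(2), of "?P - 1"] by (auto simp: padic_norm_mult padic_int_def mult_left_le)
  also have "\<dots> < 1" using card_prime_gt_1[where 'p = 'p] by (simp add: padic_norm_p)
  finally have "padic_norm (of_nat ?P * t ^ (?P - 1)) < 1" .
  from padic_norm_add_less[OF 1 this] have "padic_norm ?S < 1" by (simp only: diff_add_cancel)
  moreover have "s - t = (s - t) * ?S" using power_diff_sumr2[of s ?P t] s t by simp
  then have "?S = 1" using \<open>s \<noteq> t\<close> by simp
  ultimately show False by simp
qed

lemma teichmueller_exists:
  fixes a :: int
  shows "\<exists>t :: 'p::prime_card padic. t \<in> padic_int \<and> padic_norm (t - of_int a) < 1 \<and> t ^ CARD('p) = t"
proof -
  let ?P = "CARD('p)"
  interpret frobenius_lift ?P "\<lambda>a::int. a" by (rule frobenius_lift_int[OF prime_card])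
  define x :: "nat \<Rightarrow> 'p padic" where "x s = of_int (a ^ ?P ^ s)" for s
  have x_int: "x s \<in> padic_int" for s unfolding x_def by (rule padic_int_of_int)
  have "padic_norm (x (Suc s) - x s) \<le> (1 / real ?P) ^ Suc s" for s
  proof -
    have "int ?P ^ Suc s dvd a ^ ?P ^ Suc s - a ^ ?P ^ s" using lift_cong_power[of s a] by simp
    from padic_norm_of_int_dvd[OF this] show ?thesis by (simp add: x_def)
  qed
  then obtain t where t: "\<And>s. padic_norm (t - x s) \<le> (1 / real ?P) ^ Suc s"
    using padic_limit_exists[of x] by blast
  have P: "real ?P > 1" by (rule card_prime_gt_1)
  have t0: "padic_norm (t - of_int a) < 1"
    using t[of 0] P by (simp add: x_def divide_less_eq_1 le_less_trans)
  have t_int: "t \<in> padic_int"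
    using padic_norm_add_le[of "t - of_int a" 1 "of_int a"] t0 padic_norm_of_int_le_1[of a]
    by (simp add: padic_int_def)
  have lim: "(\<lambda>s. (1 / real ?P) ^ Suc s) \<longlonglongrightarrow> 0"
    using P by (intro LIMSEQ_power_zero[THEN LIMSEQ_Suc]) auto
  have "padic_norm (t ^ ?P - t) \<le> (1 / real ?P) ^ Suc s" for s
  proof -
    have "padic_norm (t ^ ?P - x s ^ ?P) \<le> (1 / real ?P) ^ Suc s"
      using padic_norm_power_diff_le[OF t_int x_int] t by (rule order_trans)
    moreover have "x s ^ ?P = x (Suc s)" by (simp add: x_def mult.commute flip: power_mult)
    moreover have "padic_norm (x (Suc s) - t) \<le> (1 / real ?P) ^ Suc s"
    proof -
      have "(1 / real ?P) ^ Suc (Suc s) \<le> (1 / real ?P) ^ Suc s"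
        using P by (intro power_decreasing) auto
      then show ?thesis using t[of "Suc s"] by (simp add: padic_norm_minus_commute)
    qed
    ultimately show ?thesis using padic_norm_diff_trans_le by metis
  qed
  then have "padic_norm (t ^ ?P - t) \<le> 0" by (intro LIMSEQ_le_const[OF lim]) blast
  then have "t ^ ?P = t" by (metis antisym eq_iff_diff_eq_0 padic_norm_eq_0_iff padic_norm_nonneg)
  then show ?thesis using t_int t0 by blast
qed

lemma teichmueller:
  fixes u :: "'p::prime_card mod_ring"
  shows "teichmueller u \<in> padic_int"
    and "padic_norm (teichmueller u - of_int (to_int_mod_ring u)) < 1"
proof -
  let ?Q = "\<lambda>t :: 'p padic. t \<in> padic_int \<and> padic_norm (t - of_int (to_int_mod_ring u)) < 1 \<and> t ^ CARD('p) = t"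
  have "\<exists>!t. ?Q t"
  proof (rule ex_ex1I[OF teichmueller_exists])
    fix s t assume st: "?Q s" "?Q t"
    then have "padic_norm (s - t) < 1"
      by (metis padic_norm_diff_trans_less padic_norm_minus_commute)
    then show "s = t" using st teichmueller_unique by blast
  qed
  from theI'[OF this] show "teichmueller u \<in> padic_int"
    and "padic_norm (teichmueller u - of_int (to_int_mod_ring u)) < 1"
    unfolding teichmueller_def by blast+
qed

lemma residue_disc_cover:
  fixes a :: "'p::prime_card padic"
  assumes "a \<in> padic_int"
  obtains u where "a \<in> residue_disc u"
proof -
  obtain c where c: "padic_norm (a - of_int c) < 1" using padic_int_residue[OF assms] .
  have "c mod int CARD('p) \<in> range (to_int_mod_ring :: 'p mod_ring \<Rightarrow> int)"
    unfolding range_to_int_mod_ring by auto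
  then obtain u :: "'p mod_ring" where u: "to_int_mod_ring u = c mod int CARD('p)" by auto
  have "padic_norm (of_int (c - c mod int CARD('p)) :: 'p padic) \<le> (1 / real CARD('p)) ^ 1"
    by (intro padic_norm_of_int_dvd) (simp add: minus_mod_eq_mult_div)
  also have "\<dots> < 1" using card_prime_gt_1[where 'p = 'p] by simp
  finally have "padic_norm (a - of_int (to_int_mod_ring u)) < 1"
    using padic_norm_diff_trans_less[OF c, of "of_int (to_int_mod_ring u)"] by (simp add: u)
  then have "padic_norm (a - teichmueller u) < 1"
    using teichmueller(2)[of u]
    by (metis padic_norm_diff_trans_less padic_norm_minus_commute)
  then show ?thesis using assms that by (auto simp: residue_disc_def)
qed

lemma union_residue_discs:
  fixes D :: "'p::prime_card padic set"
  assumes "D \<subseteq> padic_int"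
    and cong: "\<And>a b. a \<in> D \<Longrightarrow> b \<in> padic_int \<Longrightarrow> padic_norm (b - a) < 1 \<Longrightarrow> b \<in> D"
  shows "D = (\<Union>u\<in>{u. residue_disc u \<subseteq> D}. residue_disc u)"
proof (rule Set.set_eqI, rule iffI)
  fix a assume a: "a \<in> D"
  then obtain u where u: "a \<in> residue_disc u" using assms(1) residue_disc_cover by blast
  have "b \<in> D" if "b \<in> residue_disc u" for b
  proof (rule cong[OF a])
    show "padic_norm (b - a) < 1"
      using u that padic_norm_diff_trans_less[of b "teichmueller u" 1 a]
      by (simp add: residue_disc_def padic_norm_minus_commute)
  qed (use that in \<open>simp add: residue_disc_def\<close>)
  then show "a \<in> (\<Union>u\<in>{u. residue_disc u \<subseteq> D}. residue_disc u)" using u by blast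
qed blast

subsection \<open>Evaluation of integer polynomials\<close>

definition zpoly :: "int poly \<Rightarrow> 'p::prime_card padic poly" where
  "zpoly f = map_poly of_int f"

lemma zpoly_pCons: "zpoly (pCons c f) = pCons (of_int c) (zpoly f)"
  by (rule poly_eqI) (simp add: zpoly_def coeff_map_poly coeff_pCons split: nat.splits)

lemma zpoly_0 [simp]: "zpoly 0 = 0"
  by (simp add: zpoly_def)

lemma zpoly_mult: "zpoly (f * g) = zpoly f * zpoly g"
  by (simp add: zpoly_def of_int_poly_hom.hom_mult)

lemma zpoly_diff: "zpoly (f - g) = zpoly f - zpoly g"
  by (simp add: zpoly_def of_int_poly_hom.hom_minus)

lemma zpoly_of_nat_power: "zpoly (of_nat m ^ j) = [:of_nat m ^ j:]"
  by (rule poly_eqI) (simp add: zpoly_def coeff_map_poly of_nat_poly poly_const_pow coeff_pCons split: nat.splits)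

lemma poly_zpoly_int: "a \<in> padic_int \<Longrightarrow> poly (zpoly f) a \<in> padic_int"
  by (induction f) (auto simp: zpoly_pCons padic_int_def padic_norm_mult padic_norm_of_int_le_1
      intro!: padic_norm_add_le mult_le_one)

lemma padic_norm_poly_diff_le:
  assumes a: "a \<in> padic_int" and b: "b \<in> padic_int"
  shows "padic_norm (poly (zpoly f) a - poly (zpoly f) b) \<le> padic_norm (a - b)"
proof (induction f)
  case (pCons c f)
  have "poly (zpoly (pCons c f)) a - poly (zpoly (pCons c f)) b
      = a * (poly (zpoly f) a - poly (zpoly f) b) + (a - b) * poly (zpoly f) b"
    by (simp add: zpoly_pCons algebra_simps)
  also have "padic_norm \<dots> \<le> padic_norm (a - b)"
    using pCons a poly_zpoly_int[OF b, of f]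
    by (intro padic_norm_add_le)
       (auto simp: padic_norm_mult padic_int_def mult_left_le intro: order_trans[OF mult_left_le_one_le])
  finally show ?case .
qed simp

lemma padic_norm_poly_dvd_le:
  fixes a :: "'p::prime_card padic"
  assumes "of_nat CARD('p) ^ m dvd f" "a \<in> padic_int"
  shows "padic_norm (poly (zpoly f) a) \<le> (1 / real CARD('p)) ^ m"
proof -
  obtain g where f: "f = of_nat CARD('p) ^ m * g" using assms(1) by (auto simp: dvd_def)
  show ?thesis using poly_zpoly_int[OF assms(2), of g]
    by (simp add: f zpoly_mult zpoly_of_nat_power padic_norm_mult padic_norm_power padic_norm_p
        padic_int_def mult_left_le)
qed

subsection \<open>Power series with bounded coefficients\<close>

definition fps_bound :: "real \<Rightarrow> 'p::prime_card padic fps \<Rightarrow> bool" where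
  "fps_bound e f \<longleftrightarrow> (\<forall>n. padic_norm (fps_nth f n) \<le> e)"

lemma fps_bound_add: "fps_bound e f \<Longrightarrow> fps_bound e g \<Longrightarrow> fps_bound e (f + g)"
  by (auto simp: fps_bound_def intro: padic_norm_add_le)

lemma fps_bound_mult:
  assumes "fps_bound d f" "fps_bound e g" "d \<ge> 0" "e \<ge> 0"
  shows "fps_bound (d * e) (f * g)"
  using assms unfolding fps_bound_def fps_mult_nth
  by (auto simp: padic_norm_mult intro!: padic_norm_sum_le mult_mono)

lemma fps_bound_inverse:
  assumes f: "fps_bound 1 f" and f0: "padic_norm (fps_nth f 0) = 1"
  shows "fps_bound 1 (inverse f)"
proof -
  have f0': "fps_nth f 0 \<noteq> 0" using f0 by auto
  have "padic_norm (fps_nth (inverse f) n) \<le> 1" for n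
  proof (induction n rule: less_induct)
    case (less n)
    have "fps_nth (f * inverse f) n = fps_nth 1 n" by (simp add: inverse_mult_eq_1' f0')
    then have "(\<Sum>i\<in>{0..n}. fps_nth f i * fps_nth (inverse f) (n - i)) = (if n = 0 then 1 else 0)"
      by (simp add: fps_mult_nth)
    then have eq: "fps_nth f 0 * fps_nth (inverse f) n =
       (if n = 0 then 1 else 0) - (\<Sum>i\<in>{0<..n}. fps_nth f i * fps_nth (inverse f) (n - i))"
      by (simp add: sum.head algebra_simps)
    have "padic_norm (fps_nth f 0 * fps_nth (inverse f) n) \<le> 1"
      unfolding eq
      by (intro padic_norm_diff_le padic_norm_sum_le)
         (use f less in \<open>auto simp: fps_bound_def padic_norm_mult intro!: mult_le_one\<close>)
    then show ?case by (simp add: padic_norm_mult f0)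
  qed
  then show ?thesis by (simp add: fps_bound_def)
qed

lemma fps_bound_pcompose:
  fixes t :: "'p::prime_card padic"
  assumes "t \<in> padic_int"
  shows "fps_bound 1 (fps_of_poly (pcompose (zpoly f) [:t, 1:]))"
proof (induction f)
  case (pCons c f)
  have "fps_bound 1 (fps_of_poly [:t, 1:])" "fps_bound 1 (fps_of_poly [:of_int c :: 'p padic:])"
    using assms by (auto simp: fps_bound_def coeff_pCons padic_int_def padic_norm_of_int_le_1 split: nat.splits)
  moreover from this(1) have "fps_bound (1 * 1) (fps_of_poly [:t, 1:] * fps_of_poly (pcompose (zpoly f) [:t, 1:]))"
    by (rule fps_bound_mult[OF _ pCons(2)]) auto
  moreover have "fps_of_poly (pcompose (zpoly (pCons c f)) [:t, 1:]) = fps_of_poly [:of_int c:]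
      + fps_of_poly [:t, 1:] * fps_of_poly (pcompose (zpoly f) [:t, 1:])"
    by (simp only: zpoly_pCons pcompose_pCons fps_of_poly_add fps_of_poly_mult)
  ultimately show ?case by (metis fps_bound_add mult_1)
qed (simp add: fps_bound_def)

lemma fps_bound_pcompose_dvd:
  fixes t :: "'p::prime_card padic"
  assumes "of_nat CARD('p) ^ m dvd f" "t \<in> padic_int"
  shows "fps_bound ((1 / real CARD('p)) ^ m) (fps_of_poly (pcompose (zpoly f) [:t, 1:]))"
proof -
  obtain g where f: "f = of_nat CARD('p) ^ m * g" using assms(1) by (auto simp: dvd_def)
  have "padic_norm (poly.coeff (pcompose (zpoly g) [:t, 1:]) n) \<le> 1" for n
    using fps_bound_pcompose[OF assms(2), of g] by (simp add: fps_bound_def)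
  then show ?thesis
    by (simp add: f zpoly_mult zpoly_of_nat_power pcompose_smult fps_bound_def
        padic_norm_mult padic_norm_power padic_norm_p mult_left_le)
qed

lemma padic_norm_truncated_quotient_le:
  fixes A B :: "'p::prime_card padic poly"
  assumes bA: "fps_bound 1 (fps_of_poly A)" and bB: "fps_bound 1 (fps_of_poly B)"
    and B0: "padic_norm (poly.coeff B 0) = 1"
    and w: "padic_norm w \<le> 1"
  defines "\<gamma> \<equiv> fps_of_poly A * inverse (fps_of_poly B)"
  shows "padic_norm ((\<Sum>m<M. fps_nth \<gamma> m * w ^ m) * poly B w - poly A w) \<le> padic_norm w ^ M"
proof -
  have "fps_bound (1 * 1) \<gamma>" unfolding \<gamma>_def
    by (intro fps_bound_mult fps_bound_inverse bA bB) (auto simp: B0)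
  then have b\<gamma>: "padic_norm (fps_nth \<gamma> n) \<le> 1" for n by (simp add: fps_bound_def)
  have "fps_nth (fps_of_poly B) 0 \<noteq> 0" using B0 by auto
  then have \<gamma>B: "\<gamma> * fps_of_poly B = fps_of_poly A"
    by (simp add: \<gamma>_def mult.assoc inverse_mult_eq_1)
  define G where "G = (\<Sum>m<M. Polynomial.monom (fps_nth \<gamma> m) m)"
  have cG: "poly.coeff G n = (if n < M then fps_nth \<gamma> n else 0)" for n
    by (simp add: G_def coeff_sum coeff_monom)
  define H where "H = G * B - A"
  have H0: "poly.coeff H n = 0" if "n < M" for n
  proof -
    have "poly.coeff (G * B) n = fps_nth (\<gamma> * fps_of_poly B) n"
      using that by (auto simp: coeff_mult fps_mult_nth cG atMost_atLeast0 intro!: sum.cong)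
    then show ?thesis by (simp add: H_def \<gamma>B)
  qed
  have H1: "padic_norm (poly.coeff H n) \<le> 1" for n
    using b\<gamma> bA bB unfolding H_def coeff_diff coeff_mult
    by (intro padic_norm_diff_le padic_norm_sum_le)
       (auto simp: cG fps_bound_def padic_norm_mult intro!: mult_le_one)
  have "poly H w = (\<Sum>m<M. fps_nth \<gamma> m * w ^ m) * poly B w - poly A w"
    by (simp add: H_def G_def poly_sum poly_monom)
  moreover have "padic_norm (poly H w) \<le> padic_norm w ^ M"
    unfolding poly_altdef
  proof (intro padic_norm_sum_le)
    fix i
    show "padic_norm (poly.coeff H i * w ^ i) \<le> padic_norm w ^ M"
    proof (cases "i < M")
      case False
      then have "padic_norm w ^ i \<le> padic_norm w ^ M" using w by (intro power_decreasing) auto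
      then show ?thesis using H1[of i]
        by (auto simp: padic_norm_mult padic_norm_power intro: order_trans[OF mult_left_le_one_le])
    qed (simp add: H0)
  qed simp
  ultimately show ?thesis by simp
qed

lemma analytic_ratio_limit:
  fixes D :: "'p::prime_card padic set" and A B :: "nat \<Rightarrow> int poly"
  assumes D_int: "D \<subseteq> padic_int"
    and D_cong: "\<And>a b. a \<in> D \<Longrightarrow> b \<in> padic_int \<Longrightarrow> padic_norm (b - a) < 1 \<Longrightarrow> b \<in> D"
    and A: "\<And>s a. a \<in> D \<Longrightarrow> padic_norm (poly (zpoly (A s)) a) = 1"
    and B: "\<And>s a. a \<in> D \<Longrightarrow> padic_norm (poly (zpoly (B s)) a) = 1"
    and AB: "\<And>s. of_nat CARD('p) ^ Suc s dvd A (Suc s) * B s - A s * B (Suc s)"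
  shows "\<exists>I. uniform_limit D (\<lambda>s a. poly (zpoly (A s)) a / poly (zpoly (B s)) a) I sequentially
           \<and> padic_analytic_on D I \<and> (\<forall>a\<in>D. padic_norm (I a) = 1)"
proof -
  let ?e = "\<lambda>s. (1 / real CARD('p)) ^ Suc s"
  define f where "f s a = poly (zpoly (A s)) a / poly (zpoly (B s)) a" for s and a :: "'p padic"
  have P: "real CARD('p) > 1" by (rule card_prime_gt_1)
  have e_lim: "?e \<longlonglongrightarrow> 0"
    using P by (intro LIMSEQ_power_zero[THEN LIMSEQ_Suc]) auto
  have e_1: "?e s < 1" for s
    using P by (intro power_Suc_less_one) auto
  have f1: "padic_norm (f s a) = 1" if "a \<in> D" for s a
    using that by (simp add: f_def padic_norm_divide A B)
  have "\<exists>y. \<forall>s. padic_norm (y - f s a) \<le> ?e s" if a: "a \<in> D" for a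
  proof (rule padic_limit_exists)
    fix s
    have nz: "poly (zpoly (B m)) a \<noteq> 0" for m using B[OF a, of m] by auto
    have "f (Suc s) a - f s a = poly (zpoly (A (Suc s) * B s - A s * B (Suc s))) a
        / (poly (zpoly (B (Suc s))) a * poly (zpoly (B s)) a)"
      using nz[of s] nz[of "Suc s"] by (simp add: f_def zpoly_diff zpoly_mult diff_frac_eq)
    then have "padic_norm (f (Suc s) a - f s a) = padic_norm (poly (zpoly (A (Suc s) * B s - A s * B (Suc s))) a)"
      by (simp add: padic_norm_divide padic_norm_mult B a)
    also have "\<dots> \<le> ?e s" using D_int a by (intro padic_norm_poly_dvd_le AB) auto
    finally show "padic_norm (f (Suc s) a - f s a) \<le> ?e s" .
  qed
  then obtain I where I: "\<And>a s. a \<in> D \<Longrightarrow> padic_norm (I a - f s a) \<le> ?e s" by metis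
  have unif: "uniform_limit D f I sequentially"
  proof (rule uniform_limitI)
    fix e :: real assume "e > 0"
    then have "eventually (\<lambda>s. ?e s < e) sequentially" using order_tendstoD(2)[OF e_lim] by simp
    then show "eventually (\<lambda>s. \<forall>a\<in>D. dist (f s a) (I a) < e) sequentially"
    proof eventually_elim
      case (elim s)
      then show ?case using I[of _ s] by (auto simp: dist_padic_def padic_norm_minus_commute intro: le_less_trans)
    qed
  qed
  have I1: "padic_norm (I a) = 1" if "a \<in> D" for a
    using padic_norm_eq_1_cong[OF f1[OF that, of 0], of "I a"] I[OF that, of 0] e_1[of 0] by linarith
  have "\<exists>c. \<forall>z\<in>residue_disc u. (\<lambda>m. c m * (z - teichmueller u) ^ m) sums I z"
    if u: "residue_disc u \<subseteq> D" for u
  proof -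
    define t where "t = teichmueller u"
    have t: "t \<in> padic_int" "t \<in> D"
      using teichmueller(1)[of u] u by (auto simp: t_def residue_disc_def)
    define A' B' where "A' s = pcompose (zpoly (A s)) [:t, 1:]" and "B' s = pcompose (zpoly (B s)) [:t, 1:]" for s
    have poly': "poly (A' s) w = poly (zpoly (A s)) (t + w)" "poly (B' s) w = poly (zpoly (B s)) (t + w)" for s w
      by (simp_all add: A'_def B'_def poly_pcompose add.commute)
    have bA: "fps_bound 1 (fps_of_poly (A' s))" and bB: "fps_bound 1 (fps_of_poly (B' s))" for s
      unfolding A'_def B'_def by (rule fps_bound_pcompose[OF t(1)])+
    have B0: "padic_norm (poly.coeff (B' s) 0) = 1" for s
      using B[OF t(2), of s] poly'(2)[of s 0] by (simp add: poly_0_coeff_0)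
    have inv: "fps_bound 1 (inverse (fps_of_poly (B' s)))" for s
      by (rule fps_bound_inverse[OF bB]) (simp add: B0)
    define \<gamma> where "\<gamma> s = fps_of_poly (A' s) * inverse (fps_of_poly (B' s))" for s
    have diff: "padic_norm (fps_nth (\<gamma> (Suc s)) m - fps_nth (\<gamma> s) m) \<le> ?e s" for s m
    proof -
      have nz: "fps_nth (fps_of_poly (B' r)) 0 \<noteq> 0" for r using B0[of r] by auto
      have "fps_of_poly (A' (Suc s) * B' s - A' s * B' (Suc s)) *
          (inverse (fps_of_poly (B' (Suc s))) * inverse (fps_of_poly (B' s)))
        = \<gamma> (Suc s) * (inverse (fps_of_poly (B' s)) * fps_of_poly (B' s))
          - \<gamma> s * (inverse (fps_of_poly (B' (Suc s))) * fps_of_poly (B' (Suc s)))"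
        by (simp add: \<gamma>_def fps_of_poly_diff fps_of_poly_mult algebra_simps)
      also have "\<dots> = \<gamma> (Suc s) - \<gamma> s" by (simp only: inverse_mult_eq_1[OF nz] mult_1_right)
      finally have eq: "\<gamma> (Suc s) - \<gamma> s = fps_of_poly (A' (Suc s) * B' s - A' s * B' (Suc s)) *
          (inverse (fps_of_poly (B' (Suc s))) * inverse (fps_of_poly (B' s)))" by simp
      have "A' (Suc s) * B' s - A' s * B' (Suc s)
          = pcompose (zpoly (A (Suc s) * B s - A s * B (Suc s))) [:t, 1:]"
        by (simp add: A'_def B'_def zpoly_diff zpoly_mult pcompose_diff pcompose_mult)
      then have "fps_bound (?e s) (fps_of_poly (A' (Suc s) * B' s - A' s * B' (Suc s)))"
        using fps_bound_pcompose_dvd[OF AB t(1)] by simp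
      from fps_bound_mult[OF this fps_bound_mult[OF inv inv]]
      have "fps_bound (?e s) (\<gamma> (Suc s) - \<gamma> s)" unfolding eq by simp
      then show ?thesis by (simp add: fps_bound_def)
    qed
    have "\<exists>y. \<forall>s. padic_norm (y - fps_nth (\<gamma> s) m) \<le> ?e s" for m
      by (rule padic_limit_exists) (rule diff)
    then obtain c where c: "\<And>m s. padic_norm (c m - fps_nth (\<gamma> s) m) \<le> ?e s" by metis
    have "(\<lambda>m. c m * (z - t) ^ m) sums I z" if z: "z \<in> residue_disc u" for z
    proof -
      define w where "w = z - t"
      have w: "padic_norm w < 1" using z by (simp add: residue_disc_def w_def t_def)
      have zD: "z \<in> D" using z u by blast
      have bound: "padic_norm ((\<Sum>m<M. c m * w ^ m) - I z) \<le> padic_norm w ^ M" for M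
      proof -
        have step: "padic_norm ((\<Sum>m<M. c m * w ^ m) - I z) \<le> padic_norm w ^ M + ?e s" for s
        proof -
          have "(\<Sum>m<M. c m * w ^ m) - (\<Sum>m<M. fps_nth (\<gamma> s) m * w ^ m)
              = (\<Sum>m<M. (c m - fps_nth (\<gamma> s) m) * w ^ m)"
            by (simp add: sum_subtractf left_diff_distrib)
          also have "padic_norm \<dots> \<le> ?e s"
          proof (rule padic_norm_sum_le)
            fix m
            have "padic_norm (c m - fps_nth (\<gamma> s) m) * padic_norm w ^ m \<le> ?e s * 1"
              using w c[of m s] by (intro mult_mono power_le_one) auto
            then show "padic_norm ((c m - fps_nth (\<gamma> s) m) * w ^ m) \<le> ?e s"
              by (simp add: padic_norm_mult padic_norm_power)
          qed simp
          finally have 1: "padic_norm ((\<Sum>m<M. c m * w ^ m) - (\<Sum>m<M. fps_nth (\<gamma> s) m * w ^ m)) \<le> ?e s" .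
          have Bz: "padic_norm (poly (B' s) w) = 1" using B[OF zD, of s] by (simp add: poly' w_def)
          then have nz: "poly (B' s) w \<noteq> 0" by auto
          have fz: "f s z = poly (A' s) w / poly (B' s) w" by (simp add: f_def poly' w_def)
          have "((\<Sum>m<M. fps_nth (\<gamma> s) m * w ^ m) - f s z) * poly (B' s) w
              = (\<Sum>m<M. fps_nth (\<gamma> s) m * w ^ m) * poly (B' s) w - poly (A' s) w"
            using nz by (simp add: fz left_diff_distrib)
          then have "padic_norm ((\<Sum>m<M. fps_nth (\<gamma> s) m * w ^ m) - f s z)
              = padic_norm ((\<Sum>m<M. fps_nth (\<gamma> s) m * w ^ m) * poly (B' s) w - poly (A' s) w)"
            using padic_norm_mult[of "(\<Sum>m<M. fps_nth (\<gamma> s) m * w ^ m) - f s z" "poly (B' s) w"] Bz by simp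
          also have "\<dots> \<le> padic_norm w ^ M"
            unfolding \<gamma>_def using w by (intro padic_norm_truncated_quotient_le[OF bA bB B0]) simp
          finally have 2: "padic_norm ((\<Sum>m<M. fps_nth (\<gamma> s) m * w ^ m) - f s z) \<le> padic_norm w ^ M" .
          have 3: "padic_norm (f s z - I z) \<le> ?e s" using I[OF zD, of s] by (simp add: padic_norm_minus_commute)
          have pos: "?e s \<ge> 0" "padic_norm w ^ M \<ge> 0" by auto
          show ?thesis
            by (rule padic_norm_diff_trans_le[OF padic_norm_diff_trans_le[OF order_trans[OF 1] order_trans[OF 2]]
                  order_trans[OF 3]]) (use pos in linarith)+
        qed
        have "(\<lambda>s. padic_norm w ^ M + ?e s) \<longlonglongrightarrow> padic_norm w ^ M + 0"
          by (intro tendsto_add tendsto_const e_lim)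
        then show ?thesis using LIMSEQ_le_const[of _ "padic_norm w ^ M + 0"] step by force
      qed
      have lim: "(\<lambda>M. padic_norm w ^ M) \<longlonglongrightarrow> 0" using w by (intro LIMSEQ_power_zero) simp
      have "(\<lambda>M. dist (\<Sum>m<M. c m * w ^ m) (I z)) \<longlonglongrightarrow> 0"
        by (rule tendsto_sandwich[OF _ _ tendsto_const lim]) (auto simp: dist_padic_def bound)
      then show ?thesis unfolding sums_def w_def[symmetric] by (rule tendsto_dist_iff[THEN iffD2])
    qed
    then show ?thesis unfolding t_def by blast
  qed
  moreover have "D = (\<Union>u\<in>{u. residue_disc u \<subseteq> D}. residue_disc u)"
    by (rule union_residue_discs[OF D_int D_cong])
  ultimately have "padic_analytic_on D I"
    unfolding padic_analytic_on_def
    by (intro conjI exI[of _ "{u. residue_disc u \<subseteq> D}"] allI impI) simp_all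
  then show ?thesis using unif I1 unfolding f_def by (intro exI[of _ I] conjI ballI)
qed

lemma poly_zpoly_frob:
  fixes a :: "'p::prime_card padic"
  shows "poly (zpoly (poly_frob p f)) a = poly (zpoly f) (a ^ p)"
proof (induction f)
  case (pCons c f)
  have "zpoly (g + h) = (zpoly g + zpoly h :: 'p padic poly)" for g h
    by (simp add: zpoly_def of_int_poly_hom.hom_add)
  moreover have "zpoly (Polynomial.monom 1 p) = (Polynomial.monom 1 p :: 'p padic poly)"
    by (simp add: zpoly_def map_poly_monom)
  moreover have "poly_frob p (pCons c f) = [:c:] + Polynomial.monom 1 p * poly_frob p f"
    by (simp add: poly_frob_def pcompose_pCons)
  ultimately show ?case
    by (simp add: pCons zpoly_pCons zpoly_mult poly_monom)
qed (simp add: poly_frob_def)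

theorem theorem6p2:
  fixes k n r q l p :: nat
    and D :: "'p::prime_card padic set"
  assumes "k \<ge> 1" and "n \<ge> 2 * k"
    and "r > 0" and "q > 0" and "real r / real q \<le> 1 / 2"
    and "p = CARD('p)" and "odd p" and "l > 0" and "p = l * q + 1"
    and "D = D_set n k r q"
  shows "(\<forall>s. \<forall>a\<in>D. T_fun n k r q s (a ^ p) \<noteq> 0) \<and>
    (\<exists>I. uniform_limit D (\<lambda>s. I_fun n k r q s) I sequentially
       \<and> padic_analytic_on D I
       \<and> (\<forall>a\<in>D. I a \<in> padic_int)
       \<and> (\<forall>a\<in>D. padic_norm (I a) = 1))"
proof -
  have rq: "2 * r \<le> q"
    using assms(4,5) by (simp add: divide_le_eq)
  interpret master_setup n k r q l p
    using assms(1,2,4,7,9) rq prime_card[where 'a = 'p] by unfold_locales (auto simp: assms(6))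
  interpret Z: frobenius_lift p "poly_frob p" by (rule frobenius_lift_poly_frob[OF p])
  let ?T = "T_poly n k r q p"
  have T_fun: "T_fun n k r q s a = poly (zpoly (?T s)) a" for s and a :: "'p padic"
    by (simp add: T_fun_def zpoly_def assms(6))
  have D: "a \<in> D \<longleftrightarrow> a \<in> padic_int \<and> padic_norm (poly (zpoly (?T 1)) a) = 1" for a
    by (simp add: assms(10) D_set_def T_fun)
  have D_int: "D \<subseteq> padic_int" by (auto simp: D)
  have small: "padic_norm (poly (zpoly f) a) < 1" if "of_nat p dvd f" "a \<in> padic_int" for f and a :: "'p padic"
  proof -
    have "padic_norm (poly (zpoly f) a) \<le> (1 / real CARD('p)) ^ 1"
      using that by (intro padic_norm_poly_dvd_le) (simp_all add: assms(6))
    also have "\<dots> < 1" using card_prime_gt_1[where 'p = 'p] by simp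
    finally show ?thesis .
  qed
  have D_cong: "b \<in> D" if a: "a \<in> D" and b: "b \<in> padic_int" "padic_norm (b - a) < 1" for a b
  proof -
    have "padic_norm (poly (zpoly (?T 1)) b - poly (zpoly (?T 1)) a) < 1"
      using padic_norm_poly_diff_le[of b a "?T 1"] a b D_int by fastforce
    then show ?thesis using a b padic_norm_eq_1_cong by (auto simp: D)
  qed
  have D_power: "a ^ p \<in> D" if a: "a \<in> D" for a
  proof -
    have a_int: "a \<in> padic_int" using a D_int by blast
    have "padic_norm (poly (zpoly (?T 1 ^ p - poly_frob p (?T 1))) a) < 1"
      by (rule small[OF Z.lift_cong a_int])
    moreover have "poly (zpoly (f ^ m)) a = poly (zpoly f) a ^ m" for f m
      by (simp add: zpoly_def of_int_poly_hom.hom_power)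
    ultimately have "padic_norm (poly (zpoly (?T 1)) (a ^ p) - poly (zpoly (?T 1)) a ^ p) < 1"
      by (simp add: zpoly_diff poly_zpoly_frob padic_norm_minus_commute)
    moreover have "padic_norm (poly (zpoly (?T 1)) a ^ p) = 1" using a by (simp add: D padic_norm_power)
    ultimately show ?thesis using padic_norm_eq_1_cong a_int by (auto simp: D)
  qed
  have T_unit: "padic_norm (poly (zpoly (?T s)) a) = 1" if "a \<in> D" for s a
    using that
  proof (induction s arbitrary: a)
    case 0
    have "zpoly (?T 0) = (1 :: 'p padic poly)" by (simp add: T_poly_def zpoly_def)
    then show ?case by simp
  next
    case (Suc s)
    have T0: "?T 0 = 1" by (simp add: T_poly_def)
    have "of_nat p dvd ?T (Suc s) - ?T 1 * poly_frob p (?T s)"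
      using T_poly_dwork[of 0 s] by (simp add: T0 Z.lift_1)
    then have "padic_norm (poly (zpoly (?T (Suc s))) a - poly (zpoly (?T 1)) a * poly (zpoly (?T s)) (a ^ p)) < 1"
      using small[of _ a] Suc.prems D_int by (force simp: zpoly_diff zpoly_mult poly_zpoly_frob)
    moreover have "padic_norm (poly (zpoly (?T 1)) a * poly (zpoly (?T s)) (a ^ p)) = 1"
      using Suc.IH[OF D_power[OF Suc.prems]] Suc.prems by (simp add: padic_norm_mult D)
    ultimately show ?case using padic_norm_eq_1_cong by blast
  qed
  have nonzero: "T_fun n k r q s (a ^ p) \<noteq> 0" if "a \<in> D" for s a
    using T_unit[OF D_power[OF that], of s] by (auto simp: T_fun)
  have "\<exists>I. uniform_limit D (\<lambda>s a. poly (zpoly (?T (Suc s))) a / poly (zpoly (poly_frob p (?T s))) a) I sequentially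
      \<and> padic_analytic_on D I \<and> (\<forall>a\<in>D. padic_norm (I a) = 1)"
  proof (rule analytic_ratio_limit[OF D_int D_cong])
    show "of_nat CARD('p) ^ Suc s dvd ?T (Suc (Suc s)) * poly_frob p (?T s) - ?T (Suc s) * poly_frob p (?T (Suc s))" for s
      using T_poly_dwork[of s "Suc s"] by (simp add: assms(6))
  qed (simp_all add: T_unit poly_zpoly_frob D_power)
  then obtain I where I: "uniform_limit D (\<lambda>s. I_fun n k r q s) I sequentially"
      "padic_analytic_on D I" "\<forall>a\<in>D. padic_norm (I a) = 1"
    by (auto simp: I_fun_def[abs_def] T_fun poly_zpoly_frob assms(6))
  then have "\<forall>a\<in>D. I a \<in> padic_int" by (simp add: padic_int_def)
  then show ?thesis using nonzero I by blast
qed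

end
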